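(* Let $\mu$ be a probability distribution on $\mathbb{R}$ with mean zero and finite $p$-th moment for some $p>1$. Assume that $\mu$ has a density $\rho$, and let $Q$ be the quantile function of $\mu$. Let $q$ be the $2\pi$-periodic function given by $q(\theta)=Q(|\theta|/\pi)$ for $\theta\in(-\pi,\pi)$. Assume that the a.e. derivative $q'$ is integrable on $(-\pi,\pi)$ and that its Fourier series is obtained by termwise differentiation of the Fourier series of $q$. Then $$\Lambda(\mu)=\frac{1}{2\pi^2}\int_0^1\frac{1}{\rho(Q(x))^2}\,dx .$$ (Both sides are understood in $[0,+\infty]$.)
   Context: Quantile function: with $F(x)=\mu((-\infty,x])$ the c.d.f. of $\mu$, $Q(u)=\inf\{x: F(x)\ge u\}$ for $u\in(0,1)$. It is non-decreasing, hence differentiable a.e. Skorokhod energy of a distribution: let $\mu$ be a non-degenerate probability distribution with mean zero and finite $p$-th moment for some $p>1$. The even function $\theta\in(-\pi,\pi)\mapsto Q(|\theta|/\pi)$ has Fourier series $\sum_{n\ge 1}a_n\cos(n\theta)$, with $a_n=\frac1\pi\int_{-\pi}^{\pi}Q(|\theta|/\pi)\cos(n\theta)\,d\theta$ (the constant term vanishes because $\mu$ is centered). The function $\Psi(z)=\sum_{n\ge1}a_nz^n$ is univalent (analytic and injective) on the open unit disc $\mathbb{D}$ (known theorem of Gross), and $G=\Psi(\mathbb{D})$ is called the Gross domain generated by $\mu$. The Skorokhod energy of $\mu$ is the Skorokhod energy of $G$: $$\Lambda(\mu):=\Lambda(G)=\frac14\sum_{n=1}^{\infty}n^2a_n^2\in[0,+\infty].$$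 (In general the Skorokhod energy of a simply connected domain $U\subsetneq\mathbb{C}$ containing $0$ is $\Lambda(U)=\frac14\sum_{n\ge1}n^2|c_n|^2$, where $f(z)=\sum_{n\ge1}c_nz^n$ is any univalent map of $\mathbb{D}$ onto $U$ with $f(0)=0$; this is independent of $f$.) *)

theory Defs
  imports
    "HOL-Probability.Probability"
    "HOL-Complex_Analysis.Complex_Analysis"
begin

(* Only used for levels u strictly between 0 and 1; elsewhere the infimum need not be meaningful. *)
definition quantile :: "real measure \<Rightarrow> real \<Rightarrow> real" where
  "quantile \<mu> u = Inf {x. cdf \<mu> x \<ge> u}"

(* Coefficients of the Fourier series
   fourier_cos f 0 / 2 + (SUM n >= 1. fourier_cos f n * cos (n t) + fourier_sin f n * sin (n t))
   of a function on (-pi, pi). *)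
definition fourier_cos :: "(real \<Rightarrow> real) \<Rightarrow> nat \<Rightarrow> real" where
  "fourier_cos f n = (1 / pi) * (LINT \<theta>:{-pi<..<pi}|lborel. f \<theta> * cos (real n * \<theta>))"

definition fourier_sin :: "(real \<Rightarrow> real) \<Rightarrow> nat \<Rightarrow> real" where
  "fourier_sin f n = (1 / pi) * (LINT \<theta>:{-pi<..<pi}|lborel. f \<theta> * sin (real n * \<theta>))"

(* The Fourier series of g is the termwise derivative of that of f.  This is an identity of
   coefficients; no convergence is involved.  The case n = 0 says that g has no constant term. *)
definition fourier_series_termwise_deriv :: "(real \<Rightarrow> real) \<Rightarrow> (real \<Rightarrow> real) \<Rightarrow> bool" where
  "fourier_series_termwise_deriv f g \<longleftrightarrow>
     (\<forall>n. fourier_cos g n = real n * fourier_sin f n \<and>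
          fourier_sin g n = - real n * fourier_cos f n)"

definition gross_coeff :: "real measure \<Rightarrow> nat \<Rightarrow> real" where
  "gross_coeff \<mu> = fourier_cos (\<lambda>\<theta>. quantile \<mu> (\<bar>\<theta>\<bar> / pi))"

definition gross_map :: "real measure \<Rightarrow> complex \<Rightarrow> complex" where
  "gross_map \<mu> z = (\<Sum>n. of_real (gross_coeff \<mu> (Suc n)) * z ^ Suc n)"

definition gross_domain :: "real measure \<Rightarrow> complex set" where
  "gross_domain \<mu> = gross_map \<mu> ` ball 0 1"

definition univalent_onto :: "(complex \<Rightarrow> complex) \<Rightarrow> complex set \<Rightarrow> bool" where
  "univalent_onto f U \<longleftrightarrow>
     f holomorphic_on ball 0 1 \<and> inj_on f (ball 0 1) \<and> f ` ball 0 1 = U \<and> f 0 = 0"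

(* For a simply connected proper subdomain U of the plane containing 0, two such f differ by a
   rotation of the disc (Schwarz lemma), so the choice does not affect the moduli of the
   coefficients.  The factor n kills the term n = 0. *)
definition skorokhod_energy :: "complex set \<Rightarrow> ennreal" where
  "skorokhod_energy U =
     (let f = (SOME f. univalent_onto f U)
      in (\<Sum>n. ennreal ((real n)\<^sup>2 * (cmod (fps_nth (fps_expansion f 0) n))\<^sup>2)) / 4)"

definition skorokhod_energy_distr :: "real measure \<Rightarrow> ennreal" where
  "skorokhod_energy_distr \<mu> = skorokhod_energy (gross_domain \<mu>)"

end

theory Submission
  imports Defs
begin

text \<open>
  The even function \<open>q\<close> has an odd derivative \<open>q'\<close>, positive on \<open>(0, pi)\<close>, with sine coefficients
  \<open>b n = - n a n\<close>. Hence \<open>- z Psi'(z)\<close> is the integral of \<open>q'\<close> against the kernel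
  \<open>z sin t / (1 - 2 z cos t + z^2)\<close>, whose imaginary part is positive on the upper half disc. In the
  coordinate \<open>log z\<close> this half disc is convex, so \<open>Psi\<close> is injective there; symmetry and monotonicity on
  the real diameter give injectivity on the whole disc. By the Schwarz lemma any other univalent map
  onto the Gross domain that fixes 0 is a rotation of \<open>Psi\<close>, so the energy is a quarter of the sum of
  the \<open>(b n)^2\<close>, which Parseval's identity turns into the integral of \<open>q'^2\<close> over \<open>(0, pi)\<close>. Finally
  \<open>Q' * (rho o Q) = 1\<close> almost everywhere, because the change of variables \<open>x = Q u\<close> shows that both sides
  have the same integral over every Borel set where \<open>Q\<close> is differentiable.
\<close>

section \<open>Univalence from the sign of the derivative\<close>

text \<open>One chain rule for the three kinds of path used below: \<open>c\<close> is 1 on rays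
  from the origin, the increment of the logarithm on segments in the coordinate \<open>Ln z\<close>,
  and \<open>- \<i>\<close> where a real part is wanted.\<close>

lemma complex_deriv_Im_path:
  assumes "(f has_field_derivative d) (at (p t))" "(p has_vector_derivative v) (at t)"
  shows "((\<lambda>t. Im (f (p t) / c)) has_real_derivative Im (v * d / c)) (at t)"
proof -
  have "((f \<circ> p) has_vector_derivative v * d) (at t)"
    using field_vector_diff_chain_at[OF assms(2,1)] .
  then have "((\<lambda>t. (f \<circ> p) t / c) has_vector_derivative v * d / c) (at t)"
    by (rule has_vector_derivative_divide)
  then have "((\<lambda>t. Im ((f \<circ> p) t / c)) has_vector_derivative Im (v * d / c)) (at t)"
    by (rule bounded_linear.has_vector_derivative[OF bounded_linear_Im])
  then show ?thesis
    by (simp add: has_real_derivative_iff_has_vector_derivative o_def)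
qed

text \<open>\<open>Im (f z)\<close> has the same sign as \<open>Im z\<close>, so two points with
  equal values lie together in the upper half disc, in the lower one, or on the real diameter. The
  upper case uses the logarithmic coordinate, the lower one reduces to it by conjugation, and on the
  diameter \<open>Re f\<close> is strictly increasing.\<close>

lemma inj_on_disc_if_Im_deriv_pos:
  fixes f f' :: "complex \<Rightarrow> complex"
  assumes der: "\<And>z. norm z < 1 \<Longrightarrow> (f has_field_derivative f' z) (at z)"
    and cnj: "\<And>z. norm z < 1 \<Longrightarrow> f (cnj z) = cnj (f z)"
    and pos: "\<And>z. norm z < 1 \<Longrightarrow> Im z > 0 \<Longrightarrow> Im (z * f' z) > 0"
    and posR: "\<And>x. \<bar>x\<bar> < 1 \<Longrightarrow> Re (f' (of_real x)) > 0"
  shows "inj_on f (ball 0 1)"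
proof -
  have f_real: "Im (f (of_real x)) = 0" if "\<bar>x\<bar> < 1" for x
    using arg_cong[OF cnj[of "of_real x"], of Im] that by simp
  \<comment> \<open>On the ray from 0 to \<open>z\<close> the derivative of \<open>Im f\<close> is
    \<open>Im (w * f' w) / t\<close> at the point \<open>w = t * z\<close>, hence positive, and
    \<open>f 0\<close> is real.\<close>
  have f_upper: "Im (f z) > 0" if z: "norm z < 1" "Im z > 0" for z
  proof -
    have nz: "norm (of_real t * z) < 1" if "0 \<le> t" "t \<le> 1" for t :: real
      using that z mult_left_le_one_le[of "norm z" t] by (simp add: norm_mult)
    have d: "((\<lambda>t. Im (f (of_real t * z) / 1)) has_real_derivative Im (z * f' (of_real t * z) / 1)) (at t)"
      if "0 \<le> t" "t \<le> 1" for t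
      using nz[OF that]
      by (intro complex_deriv_Im_path[where p = "\<lambda>t. of_real t * z"] der)
        (auto intro!: derivative_eq_intros)
    have "Im (f (of_real 0 * z) / 1) < Im (f (of_real 1 * z) / 1)"
    proof (rule DERIV_pos_imp_increasing_open[where f = "\<lambda>t. Im (f (of_real t * z) / 1)"])
      fix t :: real assume t: "0 < t" "t < 1"
      have Im_scale: "Im (of_real s * w) = s * Im w" for s w by simp
      have "Im ((of_real t * z) * f' (of_real t * z)) > 0"
        using t z nz[of t] by (intro pos) auto
      then have "Im (z * f' (of_real t * z) / 1) > 0"
        using t Im_scale[of t "z * f' (of_real t * z)"] by (simp add: mult.assoc zero_less_mult_iff del: times_complex.sel)
      then show "\<exists>y. ((\<lambda>t. Im (f (of_real t * z) / 1)) has_real_derivative y) (at t) \<and> 0 < y"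
        using t by (intro exI[of _ "Im (z * f' (of_real t * z) / 1)"] conjI d) auto
    next
      show "continuous_on {0..1} (\<lambda>t. Im (f (of_real t * z) / 1))"
        using d by (intro DERIV_continuous_on[where D = "\<lambda>t. Im (z * f' (of_real t * z) / 1)"])
          (auto intro: DERIV_subset)
    qed simp
    with f_real[of 0] show ?thesis by simp
  qed
  have inj_upper: "z1 = z2"
    if z: "norm z1 < 1" "norm z2 < 1" "Im z1 > 0" "Im z2 > 0" and eq: "f z1 = f z2" for z1 z2
  proof (rule ccontr)
    \<comment> \<open>In the coordinate \<open>w = Ln z\<close> the upper half disc becomes the convex half strip
      \<open>Re w < 0 < Im w < pi\<close>, on which the derivative of \<open>f \<circ> exp\<close> has positive imaginary part.\<close>
    assume ne: "z1 \<noteq> z2"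
    have nz0: "z1 \<noteq> 0" "z2 \<noteq> 0" using z by auto
    define \<delta> where "\<delta> = Ln z2 - Ln z1"
    have \<delta>: "\<delta> \<noteq> 0" using ne nz0 by (metis \<delta>_def eq_iff_diff_eq_0 exp_Ln)
    define p where "p = (\<lambda>t::real. exp (Ln z1 + of_real t * \<delta>))"
    have ReLn: "Re (Ln z1) < 0" "Re (Ln z2) < 0"
      using z nz0 by (auto simp: ln_less_zero_iff)
    have ImLn: "0 < Im (Ln z1)" "Im (Ln z1) < pi" "0 < Im (Ln z2)" "Im (Ln z2) < pi"
      using z nz0 Im_Ln_pos_lt_imp by auto
    have Re_p: "Re (Ln z1 + of_real t * \<delta>) < 0" if "0 \<le> t" "t \<le> 1" for t
    proof -
      have "Re (Ln z1 + of_real t * \<delta>) = (1 - t) * Re (Ln z1) + t * Re (Ln z2)"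
        by (simp add: \<delta>_def algebra_simps)
      also have "\<dots> < 0" using convex_bound_lt[OF ReLn, of "1 - t" t] that by simp
      finally show ?thesis .
    qed
    have Im_p: "0 < Im (Ln z1 + of_real t * \<delta>)" "Im (Ln z1 + of_real t * \<delta>) < pi" if "0 \<le> t" "t \<le> 1" for t
    proof -
      have *: "Im (Ln z1 + of_real t * \<delta>) = (1 - t) * Im (Ln z1) + t * Im (Ln z2)"
        by (simp add: \<delta>_def algebra_simps)
      show "Im (Ln z1 + of_real t * \<delta>) < pi"
        unfolding * using convex_bound_lt[OF ImLn(2) ImLn(4), of "1 - t" t] that by simp
      have "(1 - t) * - Im (Ln z1) + t * - Im (Ln z2) < 0"
        using convex_bound_lt[of "- Im (Ln z1)" 0 "- Im (Ln z2)" "1 - t" t] ImLn that by simp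
      then show "0 < Im (Ln z1 + of_real t * \<delta>)" unfolding * by simp
    qed
    have p_disc: "norm (p t) < 1" and p_upper: "Im (p t) > 0" if "0 \<le> t" "t \<le> 1" for t
      using Re_p[OF that] Im_p[OF that] unfolding p_def Im_exp norm_exp_eq_Re
      by (simp, intro mult_pos_pos exp_gt_zero sin_gt_zero, auto)
    \<comment> \<open>The velocity of \<open>p\<close> is \<open>\<delta> * p t\<close>; dividing
      \<open>f\<close> by the constant \<open>\<delta>\<close> leaves exactly
      \<open>p t * f' (p t)\<close>, the quantity whose imaginary part is positive by
      hypothesis.\<close>
    have d: "((\<lambda>t. Im (f (p t) / \<delta>)) has_real_derivative Im (p t * f' (p t))) (at t)"
      if "0 \<le> t" "t \<le> 1" for t
    proof -
      have "((\<lambda>t::real. Ln z1 + of_real t * \<delta>) has_vector_derivative \<delta>) (at t)"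
        by (auto intro!: derivative_eq_intros)
      from field_vector_diff_chain_at[OF this DERIV_exp]
      have "(p has_vector_derivative \<delta> * p t) (at t)"
        by (simp add: p_def o_def)
      from complex_deriv_Im_path[where p = p, OF der[OF p_disc[OF that]] this, of \<delta>] \<delta>
      show ?thesis by simp
    qed
    have "Im (f (p 0) / \<delta>) < Im (f (p 1) / \<delta>)"
    proof (rule DERIV_pos_imp_increasing_open[where f = "\<lambda>t. Im (f (p t) / \<delta>)"])
      fix t :: real assume t: "0 < t" "t < 1"
      show "\<exists>y. ((\<lambda>t. Im (f (p t) / \<delta>)) has_real_derivative y) (at t) \<and> 0 < y"
        using t by (intro exI[of _ "Im (p t * f' (p t))"] conjI d pos p_disc p_upper) auto
    next
      show "continuous_on {0..1} (\<lambda>t. Im (f (p t) / \<delta>))"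
        using d by (intro DERIV_continuous_on[where D = "\<lambda>t. Im (p t * f' (p t))"])
          (auto intro: DERIV_subset)
    qed simp
    moreover have "p 0 = z1" "p 1 = z2" using nz0 by (simp_all add: p_def \<delta>_def)
    ultimately show False using eq by simp
  qed
  have inj_real: "Re (f (of_real x)) < Re (f (of_real y))" if xy: "x < y" "\<bar>x\<bar> < 1" "\<bar>y\<bar> < 1" for x y
  proof -
    \<comment> \<open>Division by \<open>- \<i>\<close> is multiplication by \<open>\<i>\<close>, so
      the imaginary part of the quotient is the real part of \<open>f\<close>.\<close>
    have d: "((\<lambda>t. Im (f (of_real t) / (- \<i>))) has_real_derivative Im (1 * f' (of_real t) / (- \<i>))) (at t)"
      if "\<bar>t\<bar> < 1" for t
      using that by (intro complex_deriv_Im_path[where p = of_real] der) (auto intro!: derivative_eq_intros)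
    have "Im (f (of_real x) / (- \<i>)) < Im (f (of_real y) / (- \<i>))"
    proof (rule DERIV_pos_imp_increasing[OF xy(1), where f = "\<lambda>t. Im (f (of_real t) / (- \<i>))"])
      fix t :: real assume t: "x \<le> t" "t \<le> y"
      then have t': "\<bar>t\<bar> < 1" using xy by auto
      show "\<exists>z. ((\<lambda>t. Im (f (of_real t) / (- \<i>))) has_real_derivative z) (at t) \<and> 0 < z"
        using d[OF t'] posR[OF t'] by (auto simp: field_simps)
    qed
    then show ?thesis by simp
  qed
  have f_lower: "Im (f z) < 0" if z: "norm z < 1" "Im z < 0" for z
    using f_upper[of "cnj z"] cnj[of z] z by simp
  show ?thesis
  proof (rule inj_onI)
    fix z1 z2 assume z: "z1 \<in> ball 0 1" "z2 \<in> ball 0 1" and eq: "f z1 = f z2"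
    have nz: "norm z1 < 1" "norm z2 < 1" using z by auto
    have f_zero: "Im (f z) = 0" if "norm z < 1" "Im z = 0" for z
      using that f_real[of "Re z"] abs_Re_le_cmod[of z] by (simp add: complex_is_Real_iff)
    have "sgn (Im z) = sgn (Im (f z))" if "norm z < 1" for z
      using f_upper[OF that] f_lower[OF that] f_zero[OF that]
      by (cases "Im z" "0::real" rule: linorder_cases) auto
    then have sgn: "sgn (Im z1) = sgn (Im z2)" using nz eq by metis
    consider "Im z1 > 0" | "Im z1 = 0" | "Im z1 < 0" by linarith
    then show "z1 = z2"
    proof cases
      case 1
      then have "Im z2 > 0" using sgn by (simp add: sgn_if split: if_splits)
      with 1 show ?thesis using inj_upper nz eq by blast
    next
      case 3
      then have "Im z2 < 0" using sgn by (simp add: sgn_if split: if_splits)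
      then have "cnj z1 = cnj z2"
        using inj_upper[of "cnj z1" "cnj z2"] 3 nz eq cnj by simp
      then show ?thesis by simp
    next
      case 2
      then have "Im z2 = 0" using sgn by (simp add: sgn_if split: if_splits)
      with 2 have *: "z1 = of_real (Re z1)" "z2 = of_real (Re z2)" by (auto simp: complex_eq_iff)
      have "\<bar>Re z1\<bar> < 1" "\<bar>Re z2\<bar> < 1" using nz abs_Re_le_cmod[of z1] abs_Re_le_cmod[of z2] by auto
      then have "Re z1 = Re z2"
        using inj_real[of "Re z1" "Re z2"] inj_real[of "Re z2" "Re z1"] eq *
        by (metis less_irrefl linorder_neqE_linordered_idom)
      with * show ?thesis by simp
    qed
  qed
qed

section \<open>Power series with sine coefficients\<close>

abbreviation lborel_0_pi :: "real measure" where
  "lborel_0_pi \<equiv> restrict_space lborel {0<..<pi}"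

text \<open>The Fourier coefficient of the odd extension of \<open>g\<close> to (-pi, pi), whence
  the factor 2. It vanishes at \<open>n = 0\<close>, so sums over these coefficients may start at 0
  or at 1.\<close>

definition sine_coeff :: "(real \<Rightarrow> real) \<Rightarrow> nat \<Rightarrow> real" where
  "sine_coeff g n = 2 / pi * (LINT t|lborel_0_pi. g t * sin (real n * t))"

lemma finite_measure_lborel_0_pi: "finite_measure lborel_0_pi"
  by (auto intro!: finite_measureI simp: space_restrict_space emeasure_restrict_space)

interpretation lborel_0_pi: finite_measure lborel_0_pi
  by (rule finite_measure_lborel_0_pi)

lemma borel_measurable_lborel_0_pi [measurable (raw)]:
  "f \<in> borel_measurable borel \<Longrightarrow> f \<in> borel_measurable lborel_0_pi"
  by (auto intro: measurable_restrict_space1)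

lemma integrable_mult_bounded:
  fixes g :: "'a \<Rightarrow> real" and h :: "'a \<Rightarrow> 'b :: {banach, second_countable_topology}"
  assumes "integrable M g" "h \<in> borel_measurable M" "\<And>x. x \<in> space M \<Longrightarrow> norm (h x) \<le> C"
  shows "integrable M (\<lambda>x. g x *\<^sub>R h x)"
proof (rule Bochner_Integration.integrable_bound)
  show "integrable M (\<lambda>x. C * g x)" using assms by simp
  have "norm (g x *\<^sub>R h x) \<le> norm (C * g x)" if "x \<in> space M" for x
    using mult_mono[OF order_refl[of "\<bar>g x\<bar>"] order_trans[OF assms(3)[OF that] abs_ge_self]]
    by (simp add: abs_mult mult.commute)
  then show "AE x in M. norm (g x *\<^sub>R h x) \<le> norm (C * g x)" by simp
qed (use assms in measurable)

lemma integrable_mult_sin: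
  fixes g :: "real \<Rightarrow> real"
  assumes "integrable lborel_0_pi g"
  shows "integrable lborel_0_pi (\<lambda>t. g t * sin (real n * t))"
  using integrable_mult_bounded[OF assms, of "\<lambda>t. sin (real n * t)" 1] by simp

lemma abs_sine_coeff_le:
  assumes g: "integrable lborel_0_pi g"
  shows "\<bar>sine_coeff g n\<bar> \<le> 2 / pi * (LINT t|lborel_0_pi. \<bar>g t\<bar>)"
proof -
  have "\<bar>LINT t|lborel_0_pi. g t * sin (real n * t)\<bar> \<le> (LINT t|lborel_0_pi. \<bar>g t * sin (real n * t)\<bar>)"
    by (rule integral_abs_bound)
  also have "\<dots> \<le> (LINT t|lborel_0_pi. \<bar>g t\<bar>)"
    using g integrable_mult_sin[OF g]
    by (intro integral_mono integrable_abs) (auto simp: abs_mult mult_left_le)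
  finally show ?thesis
    by (simp add: sine_coeff_def abs_mult divide_right_mono)
qed

section \<open>The generating kernel of the functions sin (n t)\<close>

lemma cis_factorization:
  "1 - 2 * z * of_real (cos t) + z\<^sup>2 = (1 - cis t * z) * (1 - cis (- t) * z)"
proof -
  have "(1 - cis t * z) * (1 - cis (- t) * z) = 1 - z * (cis t + cis (- t)) + z\<^sup>2 * (cis t * cis (- t))"
    by (simp add: algebra_simps power2_eq_square)
  also have "cis t + cis (- t) = 2 * of_real (cos t)"
    by (simp add: complex_eq_iff)
  also have "cis t * cis (- t) = 1"
    by (simp add: cis_mult)
  finally show ?thesis by simp
qed

lemma sine_kernel_denominator_nonzero:
  fixes z :: complex and t :: real
  assumes "norm z < 1"
  shows "1 - 2 * z * of_real (cos t) + z\<^sup>2 \<noteq> 0"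
proof -
  have "cis s * z \<noteq> 1" for s
    using assms by (metis norm_cis norm_mult norm_one mult_1 less_irrefl)
  then show ?thesis unfolding cis_factorization by simp
qed

text \<open>Writing the sine as a difference of exponentials over \<open>2 * \<i>\<close> splits the
  series into two geometric ones with ratios \<open>cis t * z\<close> and
  \<open>cis (- t) * z\<close>. The power of \<open>z\<close> is one below the frequency because the
  kernel will represent the derivative of a series.\<close>

lemma sums_sine_kernel:
  fixes z :: complex and t :: real
  assumes z: "norm z < 1"
  shows "(\<lambda>n. of_real (sin (real (Suc n) * t)) * z ^ n) sums
           (of_real (sin t) / (1 - 2 * z * of_real (cos t) + z\<^sup>2))"
proof -
  have geo: "(\<lambda>n. cis s * (cis s * z) ^ n) sums (cis s * (1 / (1 - cis s * z)))" for s
    using z by (intro sums_mult geometric_sums) (simp add: norm_mult)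
  have 1: "(\<lambda>n. (cis t * (cis t * z) ^ n - cis (- t) * (cis (- t) * z) ^ n) / (2 * \<i>)) sums
          ((cis t * (1 / (1 - cis t * z)) - cis (- t) * (1 / (1 - cis (- t) * z))) / (2 * \<i>))"
    by (intro sums_divide sums_diff geo)
  have cis_diff: "cis s - cis (- s) = 2 * \<i> * of_real (sin s)" for s
    by (simp add: complex_eq_iff)
  have "(cis t * (cis t * z) ^ n - cis (- t) * (cis (- t) * z) ^ n) / (2 * \<i>) =
        of_real (sin (real (Suc n) * t)) * z ^ n" for n
  proof -
    have "cis t * (cis t * z) ^ n - cis (- t) * (cis (- t) * z) ^ n =
        (cis t ^ Suc n - cis (- t) ^ Suc n) * z ^ n"
      by (simp add: power_mult_distrib algebra_simps)
    also have "cis t ^ Suc n - cis (- t) ^ Suc n = 2 * \<i> * of_real (sin (real (Suc n) * t))"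
      unfolding Complex.DeMoivre using cis_diff[of "real (Suc n) * t"] by simp
    finally show ?thesis by simp
  qed
  moreover have "(cis t * (1 / (1 - cis t * z)) - cis (- t) * (1 / (1 - cis (- t) * z))) / (2 * \<i>) =
      of_real (sin t) / (1 - 2 * z * of_real (cos t) + z\<^sup>2)"
  proof -
    have nz: "1 - cis t * z \<noteq> 0" "1 - cis (- t) * z \<noteq> 0"
      using sine_kernel_denominator_nonzero[OF z, of t] unfolding cis_factorization by auto
    have "cis t * (1 / (1 - cis t * z)) - cis (- t) * (1 / (1 - cis (- t) * z)) =
        (cis t - cis (- t)) / ((1 - cis t * z) * (1 - cis (- t) * z))"
      using nz by (simp add: divide_simps) (simp add: algebra_simps)
    then show ?thesis
      unfolding cis_diff cis_factorization by simp
  qed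
  ultimately show ?thesis using 1 by simp
qed

text \<open>Multiply by the conjugate of the denominator \<open>D\<close>. In
  \<open>z * cnj D\<close> the cosine term is real, and the rest has imaginary part
  \<open>Im z\<close> times 1 - |z|^2.\<close>

lemma Im_sine_kernel_pos:
  fixes z :: complex and t :: real
  assumes z: "norm z < 1" "Im z > 0" and t: "0 < t" "t < pi"
  shows "Im (z * (of_real (sin t) / (1 - 2 * z * of_real (cos t) + z\<^sup>2))) > 0"
proof -
  define D where "D = 1 - 2 * z * of_real (cos t) + z\<^sup>2"
  have D: "D \<noteq> 0" unfolding D_def by (rule sine_kernel_denominator_nonzero[OF z(1)])
  have "(norm z)\<^sup>2 < 1" using z by (simp add: power_less_one_iff abs_square_less_1)
  then have n: "(Re z)\<^sup>2 + (Im z)\<^sup>2 < 1" by (simp add: cmod_power2)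
  have "Im (z * cnj D) = Im z * (1 - ((Re z)\<^sup>2 + (Im z)\<^sup>2))"
    by (simp add: D_def power2_eq_square) (simp add: algebra_simps)
  then have "Im (z * cnj D) > 0" using n z by simp
  moreover have "z * (of_real (sin t) / D) = of_real (sin t / (norm D)\<^sup>2) * (z * cnj D)"
    using D by (simp add: complex_div_cnj[of _ D])
  moreover have "Im (of_real r * w) = r * Im w" for r w by simp
  moreover have "sin t / (norm D)\<^sup>2 > 0" using D t by (simp add: sin_gt_zero)
  ultimately have "Im (z * (of_real (sin t) / D)) > 0"
    by (simp only: mult_pos_pos)
  then show ?thesis unfolding D_def .
qed

text \<open>Completing the square turns the denominator into (x - cos t)^2 + sin^2 t, which is
  positive.\<close>

lemma Re_sine_kernel_pos:
  fixes x t :: real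
  assumes x: "\<bar>x\<bar> < 1" and t: "0 < t" "t < pi"
  shows "Re (of_real (sin t) / (1 - 2 * of_real x * of_real (cos t) + (of_real x)\<^sup>2)) > 0"
proof -
  have "(cos t)\<^sup>2 < 1"
    using sin_cos_squared_add[of t] sin_gt_zero[OF t] zero_less_power2[of "sin t"] by linarith
  moreover have "1 - 2 * x * cos t + x\<^sup>2 = (x - cos t)\<^sup>2 + (1 - (cos t)\<^sup>2)"
    by (simp add: power2_eq_square algebra_simps)
  ultimately have "1 - 2 * x * cos t + x\<^sup>2 > 0"
    by (metis add_nonneg_pos diff_gt_0_iff_gt zero_le_power2)
  moreover have "of_real (sin t) / (1 - 2 * of_real x * of_real (cos t) + (of_real x)\<^sup>2) =
      complex_of_real (sin t / (1 - 2 * x * cos t + x\<^sup>2))" by simp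
  ultimately show ?thesis using sin_gt_zero[OF t] by (simp only: Re_complex_of_real divide_pos_pos)
qed

text \<open>Sum and integral may be exchanged because the n-th term is dominated by
  \<open>\<bar>g t\<bar> * norm z ^ n\<close>, whose integrals form a convergent geometric
  series.\<close>

lemma
  fixes g :: "real \<Rightarrow> real" and z :: complex
  assumes g: "integrable lborel_0_pi g" and z: "norm z < 1"
  defines "K \<equiv> \<lambda>t. of_real (sin t) / (1 - 2 * z * of_real (cos t) + z\<^sup>2)"
  shows integrable_sine_kernel: "integrable lborel_0_pi (\<lambda>t. of_real (g t) * K t)"
    and sums_sine_coeff: "(\<lambda>n. of_real (sine_coeff g (Suc n)) * z ^ n) sums
      (of_real (2 / pi) * (LINT t|lborel_0_pi. of_real (g t) * K t))"
proof -
  define f where "f = (\<lambda>n t. complex_of_real (g t * sin (real (Suc n) * t)) * z ^ n)"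
  have int: "integrable lborel_0_pi (f n)" for n
    unfolding f_def by (intro integrable_mult_left integrable_of_real integrable_mult_sin g)
  have norm_f: "norm (f n t) \<le> \<bar>g t\<bar> * norm z ^ n" for n t
    by (auto simp: f_def norm_mult norm_power abs_mult mult_left_le intro!: mult_right_mono)
  have summable_norm: "summable (\<lambda>n. norm (f n t))" for t
    by (rule summable_comparison_test'[where g = "\<lambda>n. \<bar>g t\<bar> * norm z ^ n" and N = 0])
      (use z norm_f in \<open>auto intro!: summable_mult summable_geometric\<close>)
  have summable_int: "summable (\<lambda>n. LINT t|lborel_0_pi. norm (f n t))"
  proof (rule summable_comparison_test'[where N = 0])
    show "summable (\<lambda>n. (LINT t|lborel_0_pi. \<bar>g t\<bar>) * norm z ^ n)"
      using z by (intro summable_mult summable_geometric) simp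
    show "norm (LINT t|lborel_0_pi. norm (f n t)) \<le> (LINT t|lborel_0_pi. \<bar>g t\<bar>) * norm z ^ n" for n
    proof -
      have "(LINT t|lborel_0_pi. norm (f n t)) \<le> (LINT t|lborel_0_pi. \<bar>g t\<bar> * norm z ^ n)"
        by (intro integral_mono norm_f integrable_norm int integrable_mult_left integrable_abs g)
      then show ?thesis by (simp add: integral_nonneg)
    qed
  qed
  have suminf_f: "(\<Sum>n. f n t) = of_real (g t) * K t" for t
  proof -
    have "(\<lambda>n. of_real (g t) * (of_real (sin (real (Suc n) * t)) * z ^ n)) sums (of_real (g t) * K t)"
      unfolding K_def by (intro sums_mult sums_sine_kernel z)
    then show ?thesis by (simp add: f_def sums_iff mult.assoc)
  qed
  have f_ae: "AE t in lborel_0_pi. summable (\<lambda>n. norm (f n t))"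
    using summable_norm by simp
  show "integrable lborel_0_pi (\<lambda>t. of_real (g t) * K t)"
    using integrable_suminf[OF int f_ae summable_int] unfolding suminf_f .
  have "(\<lambda>n. of_real (2 / pi) * integral\<^sup>L lborel_0_pi (f n)) sums
      (of_real (2 / pi) * (LINT t|lborel_0_pi. of_real (g t) * K t))"
    using sums_mult[OF sums_integral[OF int f_ae summable_int], of "of_real (2/pi)"] unfolding suminf_f .
  moreover have "of_real (2 / pi) * integral\<^sup>L lborel_0_pi (f n) = of_real (sine_coeff g (Suc n)) * z ^ n" for n
    unfolding f_def sine_coeff_def integral_mult_left_zero integral_complex_of_real by simp
  ultimately show "(\<lambda>n. of_real (sine_coeff g (Suc n)) * z ^ n) sums
      (of_real (2 / pi) * (LINT t|lborel_0_pi. of_real (g t) * K t))" by simp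
qed

lemma integral_lborel_0_pi_pos:
  fixes h :: "real \<Rightarrow> real"
  assumes "integrable lborel_0_pi h" "AE t in lborel_0_pi. h t > 0"
  shows "(LINT t|lborel_0_pi. h t) > 0"
  using lborel_0_pi.integral_less_AE_space[of "\<lambda>_. 0" h] assms
  by (simp add: emeasure_restrict_space space_restrict_space)

text \<open>Termwise differentiation cancels the division by \<open>n\<close>, so the derivative of
  the series is \<open>k\<close>, the integral of \<open>g\<close> against the sine kernel. Since
  \<open>g\<close> is positive almost everywhere, the signs of the kernel pass to \<open>k\<close>
  and the injectivity criterion applies. Bounded coefficients give the radius of
  convergence.\<close>

lemma inj_on_disc_sine_series:
  fixes g :: "real \<Rightarrow> real"
  assumes g: "integrable lborel_0_pi g" and g_pos: "AE t in lborel_0_pi. g t > 0"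
    and F: "\<And>n. fps_nth F n = complex_of_real (sine_coeff g n / real n)"
  shows "fps_conv_radius F \<ge> 1" and "inj_on (eval_fps F) (ball 0 1)"
proof -
  define K where "K = (\<lambda>z t. complex_of_real (sin t) / (1 - 2 * z * of_real (cos t) + z\<^sup>2))"
  define k where "k = (\<lambda>z. of_real (2 / pi) * (LINT t|lborel_0_pi. of_real (g t) * K z t))"
  have F': "fps_nth (fps_deriv F) n = of_real (sine_coeff g (Suc n))" for n
    by (simp add: F del: of_nat_Suc)
  have k: "(\<lambda>n. fps_nth (fps_deriv F) n * z ^ n) sums k z" if "norm z < 1" for z
    unfolding F' k_def K_def by (rule sums_sine_coeff[OF g that])
  have "conv_radius (fps_nth F) \<ge> 1"
  proof (rule conv_radius_geI_ex)
    fix r :: real assume r: "0 < r" "ereal r < 1"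
    define B where "B = 2 / pi * (LINT t|lborel_0_pi. \<bar>g t\<bar>)"
    have "norm (fps_nth F n) \<le> B" for n
    proof -
      \<comment> \<open>At \<open>n = 0\<close> the quotient is 0 by the convention for division by
        zero; this also makes the series vanish at the origin.\<close>
      have "\<bar>sine_coeff g n / real n\<bar> \<le> \<bar>sine_coeff g n\<bar>"
        using mult_left_mono[of 1 "real n" "\<bar>sine_coeff g n\<bar>"]
        by (cases "n = 0") (auto simp: abs_divide divide_le_eq)
      then show ?thesis
        using abs_sine_coeff_le[OF g, of n] unfolding F B_def norm_of_real by linarith
    qed
    then have bound: "norm (fps_nth F n * of_real r ^ n) \<le> B * r ^ n" for n
      using r by (simp add: norm_mult norm_power mult_right_mono)
    have "summable (\<lambda>n. B * r ^ n)"
      using r by (intro summable_mult summable_geometric) simp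
    then have "summable (\<lambda>n. fps_nth F n * of_real r ^ n)"
      by (rule summable_comparison_test'[where N = 0]) (rule bound)
    then show "\<exists>z. norm z = r \<and> summable (\<lambda>n. fps_nth F n * z ^ n)"
      using r by (intro exI[of _ "of_real r"]) simp
  qed
  then show rad: "fps_conv_radius F \<ge> 1" by (simp add: fps_conv_radius_def)
  have z_rad: "ereal (norm z) < fps_conv_radius F" if "norm z < 1" for z :: complex
  proof -
    have "ereal (norm z) < 1" using that by simp
    then show ?thesis using rad by (rule less_le_trans)
  qed
  have der: "(eval_fps F has_field_derivative k z) (at z)" if z: "norm z < 1" for z
  proof -
    have "eval_fps (fps_deriv F) z = k z"
      using k[OF z] by (simp add: eval_fps_def sums_iff)
    then show ?thesis
      using has_field_derivative_eval_fps[OF z_rad[OF z]] by simp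
  qed
  have int: "integrable lborel_0_pi (\<lambda>t. of_real (g t) * K z t)" if "norm z < 1" for z
    unfolding K_def by (rule integrable_sine_kernel[OF g that])
  show "inj_on (eval_fps F) (ball 0 1)"
  proof (rule inj_on_disc_if_Im_deriv_pos[OF der])
    show "eval_fps F (cnj z) = cnj (eval_fps F z)" if "norm z < 1" for z
    proof -
      have "(\<lambda>n. cnj (fps_nth F n * z ^ n)) sums cnj (eval_fps F z)"
        unfolding sums_cnj eval_fps_def by (intro summable_sums summable_fps z_rad that)
      then show ?thesis by (simp add: F eval_fps_def sums_iff)
    qed
    show "Im (z * k z) > 0" if z: "norm z < 1" "Im z > 0" for z
    proof -
      have "0 < (LINT t|lborel_0_pi. Im (z * (of_real (g t) * K z t)))"
      proof (rule integral_lborel_0_pi_pos)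
        show "AE t in lborel_0_pi. 0 < Im (z * (of_real (g t) * K z t))"
          using g_pos AE_space
        proof eventually_elim
          case (elim t)
          then have "0 < Im (z * K z t)"
            unfolding K_def by (intro Im_sine_kernel_pos z) (auto simp: space_restrict_space)
          moreover have "Im (z * (of_real (g t) * K z t)) = g t * Im (z * K z t)"
            by (simp add: algebra_simps)
          ultimately show ?case using elim by simp
        qed
      qed (intro integrable_Im integrable_mult_right int z)
      also have "\<dots> = Im (z * (LINT t|lborel_0_pi. of_real (g t) * K z t))"
        by (subst integral_Im) (auto intro!: integrable_mult_right int z)
      finally have W: "0 < Im (z * (LINT t|lborel_0_pi. of_real (g t) * K z t))" .
      have "z * k z = of_real (2 / pi) * (z * (LINT t|lborel_0_pi. of_real (g t) * K z t))"
        unfolding k_def by (simp only: mult.left_commute)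
      moreover have "Im (of_real r * w) = r * Im w" for r w by simp
      moreover have "2 / pi > 0" by simp
      ultimately show ?thesis using W by (simp only: mult_pos_pos)
    qed
    show "Re (k (of_real x)) > 0" if x: "\<bar>x\<bar> < 1" for x
    proof -
      have x': "norm (complex_of_real x) < 1" using x by simp
      have "0 < (LINT t|lborel_0_pi. Re (of_real (g t) * K (of_real x) t))"
      proof (rule integral_lborel_0_pi_pos)
        show "AE t in lborel_0_pi. 0 < Re (of_real (g t) * K (of_real x) t)"
          using g_pos AE_space
        proof eventually_elim
          case (elim t)
          then have "0 < Re (K (of_real x) t)"
            unfolding K_def by (intro Re_sine_kernel_pos x) (auto simp: space_restrict_space)
          then show ?case using elim by simp
        qed
      qed (intro integrable_Re int x')
      also have "\<dots> = Re (LINT t|lborel_0_pi. of_real (g t) * K (of_real x) t)"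
        by (subst integral_Re) (auto intro!: int x')
      finally show ?thesis unfolding k_def by simp
    qed
  qed
qed

section \<open>The Parseval identity for sine series\<close>

lemma integral_cos_lborel_0_pi:
  "(LINT t|lborel_0_pi. cos (of_int k * t)) = (if k = 0 then pi else 0)"
proof -
  \<comment> \<open>Adding the two endpoints, a null set, gives the closed interval on which the
    fundamental theorem of calculus is applied.\<close>
  have "(LINT t|lborel_0_pi. cos (of_int k * t)) = (LINT t|lborel. cos (of_int k * t) * indicator {0..pi} t)"
    unfolding integral_restrict_space[of "{0<..<pi}" lborel, simplified]
    using AE_lborel_singleton[of 0] AE_lborel_singleton[of pi]
    by (intro integral_cong_AE) (auto simp: indicator_def elim!: eventually_mono[OF eventually_conj])
  also have "\<dots> = (if k = 0 then pi else 0)"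
  proof (cases "k = 0")
    case True
    then show ?thesis
      using integral_FTC_Icc_real[of 0 pi "\<lambda>t. t" "\<lambda>t. 1"] by (simp add: DERIV_ident)
  next
    case False
    have "(LINT t|lborel. cos (of_int k * t) * indicator {0..pi} t) =
        sin (of_int k * pi) / of_int k - sin (of_int k * 0) / of_int k"
      using False by (intro integral_FTC_Icc_real) (auto intro!: derivative_eq_intros)
    then show ?thesis using False by (simp add: sin_int_times_real mult.commute)
  qed
  finally show ?thesis .
qed

lemma integrable_bounded_lborel_0_pi:
  fixes f :: "real \<Rightarrow> real"
  assumes "f \<in> borel_measurable lborel_0_pi" "\<And>t. \<bar>f t\<bar> \<le> C"
  shows "integrable lborel_0_pi f"
  using assms by (intro lborel_0_pi.integrable_const_bound[where B = C]) auto

lemma integral_sin_sin_lborel_0_pi: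
  assumes "m > 0" "n > 0"
  shows "(LINT t|lborel_0_pi. sin (real m * t) * sin (real n * t)) = (if m = n then pi / 2 else 0)"
proof -
  have eq: "sin (real m * t) * sin (real n * t) =
      cos (of_int (int m - int n) * t) / 2 - cos (of_int (int m + int n) * t) / 2" for t
    by (simp add: sin_times_sin diff_divide_distrib algebra_simps)
  have int: "integrable lborel_0_pi (\<lambda>t. cos (of_int k * t))" for k
    by (rule integrable_bounded_lborel_0_pi[where C = 1]) auto
  show ?thesis
    unfolding eq using assms
    by (subst Bochner_Integration.integral_diff)
      (simp_all add: int integral_cos_lborel_0_pi flip: of_int_diff of_int_add)
qed

lemma
  fixes g :: "real \<Rightarrow> real"
  defines "S \<equiv> \<lambda>c N t. \<Sum>n\<in>{1..N}. c n * sin (real n * t)"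
  shows integral_sine_poly_square:
      "(LINT t|lborel_0_pi. (S c N t)\<^sup>2) = pi / 2 * (\<Sum>n\<in>{1..N}. (c n)\<^sup>2)"
    and integral_mult_sine_poly:
      "integrable lborel_0_pi g \<Longrightarrow>
        (LINT t|lborel_0_pi. g t * S c N t) = pi / 2 * (\<Sum>n\<in>{1..N}. sine_coeff g n * c n)"
proof -
  have *: "(S c N t)\<^sup>2 = (\<Sum>m\<in>{1..N}. \<Sum>n\<in>{1..N}. c m * c n * (sin (real m * t) * sin (real n * t)))" for t
    unfolding S_def power2_eq_square sum_product by (simp add: mult_ac)
  have int: "integrable lborel_0_pi (\<lambda>t. sin (real m * t) * sin (real n * t))" for m n
    by (rule integrable_bounded_lborel_0_pi[where C = 1]) (auto simp: abs_mult mult_le_one)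
  have "(LINT t|lborel_0_pi. (S c N t)\<^sup>2) =
      (\<Sum>m\<in>{1..N}. \<Sum>n\<in>{1..N}. c m * c n * (if m = n then pi / 2 else 0))"
    unfolding * by (simp add: int) (intro sum.cong refl arg_cong2[of _ _ _ _ "(*)"] integral_sin_sin_lborel_0_pi; simp)
  also have "\<dots> = pi / 2 * (\<Sum>n\<in>{1..N}. (c n)\<^sup>2)"
    by (simp add: if_distrib[of "(*) _"] sum_distrib_left power2_eq_square mult_ac cong: if_cong)
  finally show "(LINT t|lborel_0_pi. (S c N t)\<^sup>2) = pi / 2 * (\<Sum>n\<in>{1..N}. (c n)\<^sup>2)" .
  assume g: "integrable lborel_0_pi g"
  have "(LINT t|lborel_0_pi. g t * S c N t) = (LINT t|lborel_0_pi. (\<Sum>n\<in>{1..N}. c n * (g t * sin (real n * t))))"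
    unfolding S_def by (simp add: sum_distrib_left mult_ac)
  also have "\<dots> = (\<Sum>n\<in>{1..N}. c n * (LINT t|lborel_0_pi. g t * sin (real n * t)))"
    using integrable_mult_sin[OF g] by simp
  also have "\<dots> = pi / 2 * (\<Sum>n\<in>{1..N}. sine_coeff g n * c n)"
    by (simp add: sine_coeff_def sum_distrib_left mult_ac)
  finally show "(LINT t|lborel_0_pi. g t * S c N t) = pi / 2 * (\<Sum>n\<in>{1..N}. sine_coeff g n * c n)" .
qed

text \<open>Expand the nonnegative integral of \<open>(g t - P t)^2\<close>, where \<open>P\<close>
  is the partial sum of the sine series of \<open>g\<close>.\<close>

lemma sine_Bessel:
  assumes g: "integrable lborel_0_pi g" and g2: "integrable lborel_0_pi (\<lambda>t. (g t)\<^sup>2)"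
  shows "pi / 2 * (\<Sum>n\<in>{1..N}. (sine_coeff g n)\<^sup>2) \<le> (LINT t|lborel_0_pi. (g t)\<^sup>2)"
proof -
  let ?b = "sine_coeff g"
  define P where "P = (\<lambda>t. \<Sum>n\<in>{1..N}. ?b n * sin (real n * t))"
  have P_bd: "\<bar>P t\<bar> \<le> (\<Sum>n\<in>{1..N}. \<bar>?b n\<bar>)" for t
    unfolding P_def by (rule order_trans[OF sum_abs]) (auto intro!: sum_mono simp: abs_mult mult_left_le)
  have P_meas [measurable]: "P \<in> borel_measurable borel" unfolding P_def by simp
  have P2: "integrable lborel_0_pi (\<lambda>t. (P t)\<^sup>2)"
    using P_bd by (intro integrable_bounded_lborel_0_pi[where C = "(\<Sum>n\<in>{1..N}. \<bar>?b n\<bar>)\<^sup>2"])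
      (auto simp: abs_le_square_iff[symmetric])
  have gP: "integrable lborel_0_pi (\<lambda>t. g t * P t)"
    using integrable_mult_bounded[OF g, of P "\<Sum>n\<in>{1..N}. \<bar>?b n\<bar>"] P_bd by simp
  have "0 \<le> (LINT t|lborel_0_pi. (g t - P t)\<^sup>2)" by simp
  also have "\<dots> = (LINT t|lborel_0_pi. (g t)\<^sup>2 - 2 * (g t * P t) + (P t)\<^sup>2)"
    by (simp add: power2_diff algebra_simps)
  also have "\<dots> = (LINT t|lborel_0_pi. (g t)\<^sup>2) - 2 * (LINT t|lborel_0_pi. g t * P t) + (LINT t|lborel_0_pi. (P t)\<^sup>2)"
    using g2 gP P2 by simp
  also have "(LINT t|lborel_0_pi. g t * P t) = pi / 2 * (\<Sum>n\<in>{1..N}. ?b n * ?b n)"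
    unfolding P_def by (rule integral_mult_sine_poly[OF g])
  also have "(LINT t|lborel_0_pi. (P t)\<^sup>2) = pi / 2 * (\<Sum>n\<in>{1..N}. (?b n)\<^sup>2)"
    unfolding P_def by (rule integral_sine_poly_square)
  finally show ?thesis by (simp add: power2_eq_square)
qed

section \<open>Density of the sine polynomials\<close>

definition sine_poly :: "(real \<Rightarrow> real) \<Rightarrow> bool" where
  "sine_poly f \<longleftrightarrow> (\<exists>c N. \<forall>t. f t = (\<Sum>n\<in>{1..N}. c n * sin (real n * t)))"

lemma sine_poly_zero: "sine_poly (\<lambda>t. 0)"
  unfolding sine_poly_def by (rule exI[of _ "\<lambda>_. 0"]) simp

lemma sine_poly_sin: "sine_poly (\<lambda>t. sin (real n * t))"
proof -
  have "sin (real n * t) = (\<Sum>i\<in>{1..n}. (if i = n then 1 else 0) * sin (real i * t))" for t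
  proof -
    have "(\<Sum>i\<in>{1..n}. (if i = n then 1 else 0) * sin (real i * t)) =
        (\<Sum>i\<in>{1..n}. if i = n then sin (real i * t) else 0)"
      by (intro sum.cong) auto
    then show ?thesis by (cases "n = 0") auto
  qed
  then show ?thesis
    unfolding sine_poly_def by (intro exI[of _ "\<lambda>i. if i = n then 1 else 0"] exI[of _ n] allI)
qed

lemma sine_poly_cmult: "sine_poly f \<Longrightarrow> sine_poly (\<lambda>t. r * f t)"
  unfolding sine_poly_def
  by (elim exE, rule_tac x = "\<lambda>i. r * c i" in exI, rule_tac x = N in exI)
    (simp add: sum_distrib_left mult.assoc)

lemma sine_poly_add:
  assumes "sine_poly f" "sine_poly h"
  shows "sine_poly (\<lambda>t. f t + h t)"
proof -
  obtain c M where f: "\<And>t. f t = (\<Sum>n\<in>{1..M}. c n * sin (real n * t))"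
    using assms(1) unfolding sine_poly_def by blast
  obtain d N where h: "\<And>t. h t = (\<Sum>n\<in>{1..N}. d n * sin (real n * t))"
    using assms(2) unfolding sine_poly_def by blast
  have extend: "(\<Sum>n\<in>{1..K}. e n * sin (real n * t)) =
      (\<Sum>n\<in>{1..max M N}. (if n \<le> K then e n else 0) * sin (real n * t))"
    if "K \<le> max M N" for K and e :: "nat \<Rightarrow> real" and t
    using that by (intro sum.mono_neutral_cong_left) auto
  have "f t + h t = (\<Sum>n\<in>{1..max M N}. ((if n \<le> M then c n else 0) + (if n \<le> N then d n else 0)) * sin (real n * t))" for t
    using f[of t] h[of t] extend[of M c t] extend[of N d t]
    by (simp add: distrib_right sum.distrib)
  then show ?thesis
    unfolding sine_poly_def
    by (intro exI[of _ "\<lambda>n. (if n \<le> M then c n else 0) + (if n \<le> N then d n else 0)"] exI[of _ "max M N"] allI)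
qed

lemma sine_poly_sum:
  "finite A \<Longrightarrow> (\<And>i. i \<in> A \<Longrightarrow> sine_poly (f i)) \<Longrightarrow> sine_poly (\<lambda>t. \<Sum>i\<in>A. f i t)"
  by (induction A rule: finite_induct) (auto intro: sine_poly_zero sine_poly_add)

lemma sine_poly_mult_cos:
  assumes "sine_poly f"
  shows "sine_poly (\<lambda>t. f t * cos t)"
proof -
  obtain c N where f: "\<And>t. f t = (\<Sum>n\<in>{1..N}. c n * sin (real n * t))"
    using assms unfolding sine_poly_def by metis
  \<comment> \<open>Product-to-sum formula. For \<open>n = 1\<close> the second sine has frequency 0
    and vanishes, so no constant term arises; \<open>n - 1\<close> is a true subtraction since
    \<open>n \<ge> 1\<close>.\<close>
  have "f t * cos t = (\<Sum>n\<in>{1..N}. c n * (1 / 2 * (sin (real (n + 1) * t) + sin (real (n - 1) * t))))" for t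
    unfolding f sum_distrib_right
  proof (rule sum.cong)
    fix n assume n: "n \<in> {1..N}"
    have "sin (real n * t) * cos t = (sin (real n * t + t) + sin (real n * t - t)) / 2"
      by (rule sin_times_cos)
    moreover have "real (n + 1) * t = real n * t + t" "real (n - 1) * t = real n * t - t"
      using n by (auto simp: algebra_simps of_nat_diff)
    ultimately show "c n * sin (real n * t) * cos t =
        c n * (1 / 2 * (sin (real (n + 1) * t) + sin (real (n - 1) * t)))" by simp
  qed simp
  then show ?thesis
    by (simp only:) (intro sine_poly_sum sine_poly_cmult sine_poly_add sine_poly_sin finite_atLeastAtMost)
qed

text \<open>Start from \<open>sin t\<close> and multiply repeatedly by \<open>cos t\<close>, which
  preserves sine polynomials; then combine the monomials of \<open>p\<close> linearly.\<close>

lemma sine_poly_sin_mult_poly_cos: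
  fixes p :: "real \<Rightarrow> real"
  assumes "real_polynomial_function p"
  shows "sine_poly (\<lambda>t. sin t * p (cos t))"
proof -
  obtain a n where p: "p = (\<lambda>x. \<Sum>i\<le>n. a i * x ^ i)"
    using real_polynomial_function_imp_sum[OF assms] by blast
  have "sine_poly (\<lambda>t. sin t * cos t ^ i)" for i :: nat
  proof (induction i)
    case 0
    then show ?case using sine_poly_sin[of 1] by simp
  next
    case (Suc i)
    from sine_poly_mult_cos[OF this] show ?case by (simp add: mult_ac)
  qed
  then have "sine_poly (\<lambda>t. \<Sum>i\<le>n. a i * (sin t * cos t ^ i))"
    by (intro sine_poly_sum sine_poly_cmult) auto
  then show ?thesis by (simp add: p sum_distrib_left mult_ac)
qed

lemma continuous_sine_poly:
  assumes "sine_poly f"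
  shows "continuous_on A f"
proof -
  obtain c N where "f = (\<lambda>t. \<Sum>n\<in>{1..N}. c n * sin (real n * t))"
    using assms unfolding sine_poly_def by blast
  then show ?thesis by (auto intro!: continuous_intros)
qed

text \<open>Dividing by \<open>sin t\<close>, cut off near the endpoints, and substituting \<open>x = cos t\<close> reduces
  the density of the sine polynomials to the Weierstrass theorem on \<open>[-1, 1]\<close>.\<close>

lemma sine_poly_dense:
  fixes \<phi> :: "real \<Rightarrow> real"
  assumes \<phi>: "\<phi> \<in> borel_measurable lborel_0_pi" and bd: "\<And>t. \<bar>\<phi> t\<bar> \<le> M"
  obtains P where "\<And>n. sine_poly (P n)" "\<And>n t. t \<in> {0<..<pi} \<Longrightarrow> \<bar>P n t\<bar> \<le> M + 1"
    "AE t in lborel_0_pi. (\<lambda>n::nat. P n t) \<longlonglongrightarrow> \<phi> t"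
proof -
  have M: "M \<ge> 0" using bd[of 0] by simp
  have "(\<lambda>t. indicator {0<..<pi} t *\<^sub>R \<phi> t) \<in> borel_measurable borel"
    using \<phi> by (simp add: borel_measurable_restrict_space_iff)
  \<comment> \<open>The notion \<open>measurable_on\<close> supplies continuous functions
    \<open>G n\<close> that converge to the zero extension of \<open>\<phi>\<close> off a negligible
    set.\<close>
  then have "(\<lambda>t. indicator {0<..<pi} t *\<^sub>R \<phi> t) measurable_on UNIV"
    unfolding measurable_on_iff_borel_measurable[where S = UNIV, simplified]
    by (intro measurable_restrict_space1 measurable_completion) simp
  then obtain X G where X: "negligible X" and G: "\<And>n. continuous_on UNIV (G n)"
    and lim: "\<And>t. t \<notin> X \<Longrightarrow> (\<lambda>n::nat. G n t) \<longlonglongrightarrow> indicator {0<..<pi} t *\<^sub>R \<phi> t"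
    unfolding measurable_on_def by auto
  \<comment> \<open>Clamping to [-M, M] bounds the approximants uniformly and keeps the limit. In
    \<open>\<kappa>\<close> the floor \<open>1 / real (Suc n)\<close> keeps the quotient continuous
    up to the endpoints; at each interior \<open>t\<close> it becomes inactive for large
    \<open>n\<close>, and then \<open>sin t * \<kappa> n t = H n t\<close>.\<close>
  define H where "H = (\<lambda>n t. max (- M) (min M (G n t)))"
  define \<kappa> where "\<kappa> = (\<lambda>n t. H n t / max (sin t) (1 / real (Suc n)))"
  have H_bd: "\<bar>H n t\<bar> \<le> M" for n t unfolding H_def using M by auto
  have pos: "max (sin t) (1 / real (Suc n)) > 0" for t n
    by (simp add: less_max_iff_disj del: of_nat_Suc)
  have cont: "continuous_on {-1..1} (\<lambda>x. \<kappa> n (arccos x))" for n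
    unfolding \<kappa>_def H_def using pos
    by (intro continuous_intros continuous_on_compose2[OF G continuous_on_arccos']
        continuous_on_compose2[OF continuous_on_sin[OF continuous_on_id] continuous_on_arccos'])
      (auto simp: less_imp_neq[symmetric] simp del: of_nat_Suc)
  have "\<exists>p. real_polynomial_function p \<and> (\<forall>x\<in>{-1..1}. \<bar>\<kappa> n (arccos x) - p x\<bar> < 1 / real (Suc n))" for n
    using Stone_Weierstrass_real_polynomial_function[OF _ cont, of "1 / real (Suc n)" n]
    by (metis compact_Icc divide_pos_pos of_nat_0_less_iff zero_less_Suc zero_less_one)
  then obtain p where p: "\<And>n. real_polynomial_function (p n)"
    and approx: "\<And>n x. x \<in> {-1..1} \<Longrightarrow> \<bar>\<kappa> n (arccos x) - p n x\<bar> < 1 / real (Suc n)"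
    by metis
  define P where "P = (\<lambda>n t. sin t * p n (cos t))"
  have P_approx: "\<bar>sin t * \<kappa> n t - P n t\<bar> \<le> 1 / real (Suc n)" if t: "t \<in> {0<..<pi}" for n t
  proof -
    have "\<bar>\<kappa> n t - p n (cos t)\<bar> < 1 / real (Suc n)"
      using approx[of "cos t" n] t by (simp add: arccos_cos)
    moreover have "\<bar>sin t * \<kappa> n t - P n t\<bar> = \<bar>sin t\<bar> * \<bar>\<kappa> n t - p n (cos t)\<bar>"
      by (simp add: P_def abs_mult right_diff_distrib[symmetric])
    ultimately show ?thesis
      using mult_left_le_one_le[of "\<bar>\<kappa> n t - p n (cos t)\<bar>" "\<bar>sin t\<bar>"] abs_sin_le_one[of t] by simp
  qed
  have \<kappa>_bd: "\<bar>sin t * \<kappa> n t\<bar> \<le> M" if t: "t \<in> {0<..<pi}" for n t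
  proof -
    have "sin t \<ge> 0" using t by (simp add: sin_ge_zero)
    then have "\<bar>sin t * \<kappa> n t\<bar> = \<bar>H n t\<bar> * (sin t / max (sin t) (1 / real (Suc n)))"
      using pos[of t n] by (simp add: \<kappa>_def abs_mult abs_divide)
    also have "\<dots> \<le> \<bar>H n t\<bar> * 1"
      using pos[of t n] by (intro mult_left_mono) (auto simp: divide_le_eq simp del: of_nat_Suc)
    finally show ?thesis using H_bd[of n t] by simp
  qed
  show thesis
  proof
    show "sine_poly (P n)" for n
      unfolding P_def by (rule sine_poly_sin_mult_poly_cos[OF p])
    \<comment> \<open>\<open>M\<close> bounds the clamped part and 1 bounds the polynomial
      approximation error.\<close>
    show "\<bar>P n t\<bar> \<le> M + 1" if "t \<in> {0<..<pi}" for n t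
    proof -
      have "1 / real (Suc n) \<le> 1" by simp
      then show ?thesis using P_approx[OF that, of n] \<kappa>_bd[OF that, of n] by linarith
    qed
    have "AE t in lborel. t \<notin> X"
    proof -
      have "AE t in lebesgue. t \<notin> X"
        using X by (intro AE_not_in) (simp add: negligible_iff_null_sets)
      then show ?thesis by (simp add: AE_completion_iff)
    qed
    then have "AE t in lborel_0_pi. t \<notin> X"
      by (auto simp: AE_restrict_space_iff elim: eventually_mono)
    then show "AE t in lborel_0_pi. (\<lambda>n. P n t) \<longlonglongrightarrow> \<phi> t"
      using AE_space
    proof eventually_elim
      case (elim t)
      then have t: "t \<in> {0<..<pi}" by (simp add: space_restrict_space)
      have "(\<lambda>n. H n t) \<longlonglongrightarrow> max (- M) (min M (\<phi> t))"
        unfolding H_def using lim[OF elim(1)] t by (intro tendsto_intros) simp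
      then have H_lim: "(\<lambda>n. H n t) \<longlonglongrightarrow> \<phi> t"
        using bd[of t] by (simp add: abs_le_iff min_def max_def split: if_splits)
      have "(\<lambda>n. 1 / real (Suc n)) \<longlonglongrightarrow> 0"
        using LIMSEQ_inverse_real_of_nat by (simp add: inverse_eq_divide)
      moreover have "sin t > 0" using t by (simp add: sin_gt_zero)
      ultimately have "\<forall>\<^sub>F n in sequentially. 1 / real (Suc n) < sin t"
        by (rule order_tendstoD)
      then have "\<forall>\<^sub>F n in sequentially. H n t = sin t * \<kappa> n t"
        by eventually_elim (use \<open>sin t > 0\<close> in \<open>simp add: \<kappa>_def max_def\<close>)
      then have 1: "(\<lambda>n. sin t * \<kappa> n t) \<longlonglongrightarrow> \<phi> t"
        using H_lim by (rule Lim_transform_eventually[rotated])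
      have "(\<lambda>n. sin t * \<kappa> n t - P n t) \<longlonglongrightarrow> 0"
        by (rule Lim_null_comparison[OF _ \<open>(\<lambda>n. 1 / real (Suc n)) \<longlonglongrightarrow> 0\<close>])
          (use P_approx[OF t] in simp)
      from tendsto_diff[OF 1 this] show ?case by simp
    qed
  qed
qed

text \<open>For a sine polynomial with coefficients \<open>c n\<close> the left side is pi/2 times
  the sum of 2 b c - c^2, and 2 b c - c^2 \<le> b^2 term by term. Density and dominated convergence
  extend the bound to bounded \<open>\<phi>\<close>. The left side makes sense for an integrable
  \<open>g\<close>, and choosing \<open>\<phi>\<close> as a truncation of \<open>g\<close> recovers
  the integral of \<open>g^2\<close>.\<close>

lemma sine_series_energy_ge_bounded:
  fixes \<phi> :: "real \<Rightarrow> real"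
  assumes g: "integrable lborel_0_pi g" and sm: "summable (\<lambda>n. (sine_coeff g n)\<^sup>2)"
    and \<phi>: "\<phi> \<in> borel_measurable lborel_0_pi" and bd: "\<And>t. \<bar>\<phi> t\<bar> \<le> M"
  shows "2 * (LINT t|lborel_0_pi. g t * \<phi> t) - (LINT t|lborel_0_pi. (\<phi> t)\<^sup>2) \<le>
    pi / 2 * (\<Sum>n. (sine_coeff g n)\<^sup>2)" (is "_ \<le> ?E")
proof -
  let ?b = "sine_coeff g"
  obtain P where P: "\<And>n. sine_poly (P n)" and P_bd: "\<And>n t. t \<in> {0<..<pi} \<Longrightarrow> \<bar>P n t\<bar> \<le> M + 1"
    and lim: "AE t in lborel_0_pi. (\<lambda>n::nat. P n t) \<longlonglongrightarrow> \<phi> t"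
    using sine_poly_dense[OF \<phi> bd] by metis
  have P_meas [measurable]: "P n \<in> borel_measurable borel" for n
    by (intro borel_measurable_continuous_onI continuous_sine_poly P)
  have [measurable]: "g \<in> borel_measurable lborel_0_pi" using g by simp
  note \<phi> [measurable]
  have le: "2 * (LINT t|lborel_0_pi. g t * P k t) - (LINT t|lborel_0_pi. (P k t)\<^sup>2) \<le> ?E" for k
  proof -
    obtain c N where PN: "P k = (\<lambda>t. \<Sum>n\<in>{1..N}. c n * sin (real n * t))"
      using P[of k] unfolding sine_poly_def by blast
    have "2 * (LINT t|lborel_0_pi. g t * P k t) - (LINT t|lborel_0_pi. (P k t)\<^sup>2) =
        pi / 2 * (\<Sum>n\<in>{1..N}. 2 * (?b n * c n) - (c n)\<^sup>2)"
      unfolding PN integral_mult_sine_poly[OF g] integral_sine_poly_square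
      by (simp add: sum_subtractf sum_distrib_left algebra_simps)
    also have "\<dots> \<le> pi / 2 * (\<Sum>n\<in>{1..N}. (?b n)\<^sup>2)"
    proof -
      have "2 * (?b n * c n) - (c n)\<^sup>2 \<le> (?b n)\<^sup>2" for n
        using zero_le_power2[of "?b n - c n"] by (simp add: power2_diff algebra_simps)
      then show ?thesis by (intro mult_left_mono sum_mono) auto
    qed
    also have "\<dots> \<le> ?E"
      using sm by (intro mult_left_mono sum_le_suminf) auto
    finally show ?thesis .
  qed
  have M: "M \<ge> 0" using bd[of 0] by simp
  have 1: "(\<lambda>k. LINT t|lborel_0_pi. g t * P k t) \<longlonglongrightarrow> (LINT t|lborel_0_pi. g t * \<phi> t)"
  proof (rule integral_dominated_convergence[where w = "\<lambda>t. \<bar>g t\<bar> * (M + 1)"])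
    show "AE t in lborel_0_pi. (\<lambda>k. g t * P k t) \<longlonglongrightarrow> g t * \<phi> t"
      using lim by eventually_elim (intro tendsto_intros)
    show "AE t in lborel_0_pi. norm (g t * P k t) \<le> \<bar>g t\<bar> * (M + 1)" for k
      using P_bd by (intro AE_I2) (auto simp: space_restrict_space abs_mult intro!: mult_left_mono)
  qed (use g in auto)
  have 2: "(\<lambda>k. LINT t|lborel_0_pi. (P k t)\<^sup>2) \<longlonglongrightarrow> (LINT t|lborel_0_pi. (\<phi> t)\<^sup>2)"
  proof (rule integral_dominated_convergence[where w = "\<lambda>t. (M + 1)\<^sup>2"])
    show "AE t in lborel_0_pi. (\<lambda>k. (P k t)\<^sup>2) \<longlonglongrightarrow> (\<phi> t)\<^sup>2"
      using lim by eventually_elim (intro tendsto_intros)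
    show "AE t in lborel_0_pi. norm ((P k t)\<^sup>2) \<le> (M + 1)\<^sup>2" for k
    proof (rule AE_I2)
      fix t assume "t \<in> space lborel_0_pi"
      then have "\<bar>P k t\<bar> \<le> M + 1" using P_bd by (simp add: space_restrict_space)
      from power_mono[OF this, of 2] show "norm ((P k t)\<^sup>2) \<le> (M + 1)\<^sup>2" by simp
    qed
  qed auto
  have "(\<lambda>k. 2 * (LINT t|lborel_0_pi. g t * P k t) - (LINT t|lborel_0_pi. (P k t)\<^sup>2)) \<longlonglongrightarrow>
      2 * (LINT t|lborel_0_pi. g t * \<phi> t) - (LINT t|lborel_0_pi. (\<phi> t)\<^sup>2)"
    by (intro tendsto_intros 1 2)
  then show ?thesis using le by (intro LIMSEQ_le_const2) auto
qed

text \<open>The bound from above is Bessel's inequality, or trivial when the integral is infinite.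
  The bound from below is trivial for a divergent sum; otherwise truncations of \<open>g\<close> are
  inserted into the preceding inequality and monotone convergence removes the truncation.\<close>

theorem sine_Parseval:
  assumes g: "integrable lborel_0_pi g"
  shows "(\<Sum>n. ennreal ((sine_coeff g n)\<^sup>2)) =
    ennreal (2 / pi) * (\<integral>\<^sup>+t. ennreal ((g t)\<^sup>2) \<partial>lborel_0_pi)" (is "?L = _ * ?R")
proof (rule antisym)
  let ?b = "sine_coeff g"
  have [measurable]: "g \<in> borel_measurable lborel_0_pi" using g by simp
  have cancel: "ennreal (2 / pi) * ennreal (pi / 2 * x) = ennreal x" for x
    by (subst ennreal_mult'[symmetric]) auto
  show "?L \<le> ennreal (2 / pi) * ?R"
  proof (cases "integrable lborel_0_pi (\<lambda>t. (g t)\<^sup>2)")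
    case True
    have le: "(\<Sum>n<N. ennreal ((?b n)\<^sup>2)) \<le> ennreal (2 / pi) * ?R" for N
    proof -
      have "(\<Sum>n<N. (?b n)\<^sup>2) \<le> (\<Sum>n\<in>{0..N}. (?b n)\<^sup>2)"
        by (intro sum_mono2) auto
      also have "\<dots> = (\<Sum>n\<in>{1..N}. (?b n)\<^sup>2)"
        by (simp add: sum.atLeast_Suc_atMost sine_coeff_def)
      finally have "pi / 2 * (\<Sum>n<N. (?b n)\<^sup>2) \<le> (LINT t|lborel_0_pi. (g t)\<^sup>2)"
        by (intro order_trans[OF mult_left_mono sine_Bessel[OF g True, of N]]) simp_all
      then have "ennreal (pi / 2 * (\<Sum>n<N. (?b n)\<^sup>2)) \<le> ?R"
        by (simp add: nn_integral_eq_integral[OF True] ennreal_leI)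
      then have "ennreal (2 / pi) * ennreal (pi / 2 * (\<Sum>n<N. (?b n)\<^sup>2)) \<le> ennreal (2 / pi) * ?R"
        by (intro mult_left_mono) auto
      then show ?thesis unfolding cancel by (simp add: sum_nonneg)
    qed
    then show ?thesis by (intro suminf_le_const) auto
  next
    case False
    then have "?R = \<infinity>"
      by (auto simp: integrable_iff_bounded less_top[symmetric])
    then show ?thesis by (simp add: ennreal_mult_top)
  qed
  show "ennreal (2 / pi) * ?R \<le> ?L"
  proof (cases "summable (\<lambda>n. (?b n)\<^sup>2)")
    case True
    define \<phi> where "\<phi> = (\<lambda>m::nat. \<lambda>t. max (- real m) (min (real m) (g t)))"
    have \<phi>_meas [measurable]: "\<phi> m \<in> borel_measurable lborel_0_pi" for m unfolding \<phi>_def by simp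
    have \<phi>_bd: "\<bar>\<phi> m t\<bar> \<le> real m" for m t unfolding \<phi>_def by auto
    have int_sq: "integrable lborel_0_pi (\<lambda>t. (\<phi> m t)\<^sup>2)" for m
    proof (rule integrable_bounded_lborel_0_pi)
      show "\<bar>(\<phi> m t)\<^sup>2\<bar> \<le> (real m)\<^sup>2" for t using power_mono[OF \<phi>_bd[of m t], of 2] by simp
    qed simp
    have le: "(\<integral>\<^sup>+t. ennreal ((\<phi> m t)\<^sup>2) \<partial>lborel_0_pi) \<le> ennreal (pi / 2 * (\<Sum>n. (?b n)\<^sup>2))" for m
    proof -
      \<comment> \<open>Truncation shrinks \<open>g\<close> without changing its sign, so the square
        of \<open>\<phi> m\<close> is at most \<open>g * \<phi> m\<close>. Hence its integral is at
        most twice that of \<open>g * \<phi> m\<close> minus itself, which is bounded by the energy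
        of the series.\<close>
      have "(LINT t|lborel_0_pi. (\<phi> m t)\<^sup>2) \<le> (LINT t|lborel_0_pi. g t * \<phi> m t)"
      proof (rule integral_mono)
        show "integrable lborel_0_pi (\<lambda>t. g t * \<phi> m t)"
          using integrable_mult_bounded[OF g \<phi>_meas[of m], of "real m"] \<phi>_bd by simp
        show "(\<phi> m t)\<^sup>2 \<le> g t * \<phi> m t" for t
          using mult_left_mono[of "real m" "g t" "real m"] mult_left_mono[of "real m" "- g t" "real m"]
          by (auto simp: \<phi>_def power2_eq_square min_def max_def mult.commute)
      qed (rule int_sq)
      then have "(LINT t|lborel_0_pi. (\<phi> m t)\<^sup>2) \<le> pi / 2 * (\<Sum>n. (?b n)\<^sup>2)"
        using sine_series_energy_ge_bounded[OF g True \<phi>_meas \<phi>_bd, of m] by linarith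
      then show ?thesis by (simp add: nn_integral_eq_integral[OF int_sq] ennreal_leI)
    qed
    have "(\<lambda>m. \<integral>\<^sup>+t. ennreal ((\<phi> m t)\<^sup>2) \<partial>lborel_0_pi) \<longlonglongrightarrow> ?R"
    proof (rule nn_integral_LIMSEQ)
      show "incseq (\<lambda>m t. ennreal ((\<phi> m t)\<^sup>2))"
      proof (intro incseq_SucI le_funI ennreal_leI)
        show "(\<phi> m t)\<^sup>2 \<le> (\<phi> (Suc m) t)\<^sup>2" for m t
          unfolding abs_le_square_iff[symmetric] \<phi>_def abs_le_iff by (auto simp: min_def max_def)
      qed
      show "(\<lambda>m. ennreal ((\<phi> m t)\<^sup>2)) \<longlonglongrightarrow> ennreal ((g t)\<^sup>2)" for t
      proof (rule tendsto_eventually)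
        have "\<forall>\<^sub>F m in sequentially. \<bar>g t\<bar> \<le> real m"
          using eventually_ge_at_top[of "nat \<lceil>\<bar>g t\<bar>\<rceil>"] by eventually_elim linarith
        then show "\<forall>\<^sub>F m in sequentially. ennreal ((\<phi> m t)\<^sup>2) = ennreal ((g t)\<^sup>2)"
        proof eventually_elim
          case (elim m)
          then have "\<phi> m t = g t" unfolding \<phi>_def by linarith
          then show ?case by simp
        qed
      qed
    qed simp
    then have "?R \<le> ennreal (pi / 2 * (\<Sum>n. (?b n)\<^sup>2))"
      by (rule LIMSEQ_le_const2) (use le in auto)
    then have "ennreal (2 / pi) * ?R \<le> ennreal (2 / pi) * ennreal (pi / 2 * (\<Sum>n. (?b n)\<^sup>2))"
      by (intro mult_left_mono) auto
    also have "\<dots> = ?L" unfolding cancel by (rule suminf_ennreal2[symmetric]) (use True in auto)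
    finally show ?thesis .
  next
    case False
    have "?L = top"
      by (rule ccontr, rule False[THEN notE], rule summable_suminf_not_top) simp_all
    then show ?thesis by (simp only: top_greatest)
  qed
qed

section \<open>The derivative of the quantile function\<close>

text \<open>The equivalence of \<open>u \<le> cdf \<mu> x\<close> and
  \<open>quantile \<mu> u \<le> x\<close> gives one inequality. If the other failed, left continuity
  of the cdf would produce a point below the quantile whose cdf still exceeds
  \<open>u\<close>.\<close>

lemma cdf_quantile:
  assumes \<mu>: "real_distribution \<mu>" and no_atom: "\<And>x. measure \<mu> {x} = 0" and u: "0 < u" "u < 1"
  shows "cdf \<mu> (quantile \<mu> u) = u"
proof -
  interpret cdf_distribution \<mu> unfolding cdf_distribution_def by (rule \<mu>)
  have gal: "u \<le> cdf \<mu> x \<longleftrightarrow> quantile \<mu> u \<le> x" for x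
    unfolding quantile_def by (rule pseudoinverse[OF u])
  have "u \<le> cdf \<mu> (quantile \<mu> u)" using gal by simp
  moreover have "\<not> u < cdf \<mu> (quantile \<mu> u)"
  proof
    assume less: "u < cdf \<mu> (quantile \<mu> u)"
    have "isCont (cdf \<mu>) (quantile \<mu> u)" by (simp add: isCont_cdf no_atom)
    then have lim: "(cdf \<mu> \<longlongrightarrow> cdf \<mu> (quantile \<mu> u)) (at_left (quantile \<mu> u))"
      unfolding isCont_def filterlim_at_split by (rule conjunct1)
    have "\<forall>\<^sub>F x in at_left (quantile \<mu> u). x < quantile \<mu> u"
      by (simp add: eventually_at_filter)
    with order_tendstoD(1)[OF lim less]
    have "\<forall>\<^sub>F x in at_left (quantile \<mu> u). u < cdf \<mu> x \<and> x < quantile \<mu> u"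
      by (rule eventually_conj)
    then obtain x where "u < cdf \<mu> x" "x < quantile \<mu> u"
      using eventually_happens'[OF trivial_limit_at_left_real] by blast
    then show False using gal[of x] by simp
  qed
  ultimately show ?thesis by simp
qed

lemma measure_density_lborel_singleton:
  fixes x :: "'a :: euclidean_space"
  assumes "f \<in> borel_measurable borel"
  shows "measure (density lborel f) {x} = 0"
proof -
  have "AE y in lborel. y \<in> {x} \<longrightarrow> f y = 0"
    using AE_lborel_singleton[of x] by eventually_elim simp
  then have "{x} \<in> null_sets (density lborel f)"
    using assms by (subst null_sets_density_iff) simp_all
  then show ?thesis by (simp add: null_sets_def measure_def)
qed

text \<open>\<open>\<mu>\<close> is the image of Lebesgue measure on (0, 1) under the quantile
  function, and this function is injective there because the cdf is a left inverse.\<close>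

lemma measure_quantile_image:
  assumes \<mu>: "real_distribution \<mu>" and no_atom: "\<And>x. measure \<mu> {x} = 0"
    and T: "T \<in> sets borel" "T \<subseteq> {0<..<1}"
  shows "quantile \<mu> ` T \<in> sets borel" "measure \<mu> (quantile \<mu> ` T) = measure lborel T"
proof -
  interpret cdf_distribution \<mu> unfolding cdf_distribution_def by (rule \<mu>)
  let ?Q = "quantile \<mu>"
  have Q_eq: "I = ?Q" by (simp add: quantile_def fun_eq_iff)
  have F: "cdf \<mu> (?Q u) = u" if "u \<in> {0<..<1}" for u
    using that by (intro cdf_quantile \<mu> no_atom) auto
  have [measurable]: "(\<lambda>u. indicator {0<..<1} u *\<^sub>R ?Q u) \<in> borel_measurable borel"
    using measurable_CI unfolding Q_eq by (simp add: borel_measurable_restrict_space_iff)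
  note T(1) [measurable]
  \<comment> \<open>The left inverse replaces the image by a preimage: \<open>x\<close> lies in it
    iff \<open>cdf \<mu> x\<close> is in \<open>T\<close> and \<open>?Q\<close> sends that level
    back to \<open>x\<close>. The indicator makes \<open>?Q\<close> Borel on the whole line.\<close>
  have "?Q ` T = {x \<in> space borel. cdf \<mu> x \<in> T \<and> indicator {0<..<1} (cdf \<mu> x) *\<^sub>R ?Q (cdf \<mu> x) = x}"
  proof (intro set_eqI iffI)
    fix x assume "x \<in> ?Q ` T"
    then obtain u where u: "u \<in> T" "x = ?Q u" by blast
    then show "x \<in> {x \<in> space borel. cdf \<mu> x \<in> T \<and> indicator {0<..<1} (cdf \<mu> x) *\<^sub>R ?Q (cdf \<mu> x) = x}"
      using F[of u] T(2) by (simp add: subset_iff)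
  next
    fix x assume x: "x \<in> {x \<in> space borel. cdf \<mu> x \<in> T \<and> indicator {0<..<1} (cdf \<mu> x) *\<^sub>R ?Q (cdf \<mu> x) = x}"
    then have "cdf \<mu> x \<in> {0<..<1}" using T(2) by blast
    then have "x = ?Q (cdf \<mu> x)" using x by simp
    then show "x \<in> ?Q ` T" using x by blast
  qed
  also have "\<dots> \<in> sets borel" by measurable
  finally show Q_T: "?Q ` T \<in> sets borel" .
  have inj: "inj_on ?Q {0<..<1}" by (rule inj_on_inverseI[where g = "cdf \<mu>"]) (rule F)
  have "measure \<mu> (?Q ` T) = measure (distr (restrict_space lborel {0<..<1}) borel ?Q) (?Q ` T)"
    using distr_I_eq_M unfolding Q_eq by simp
  also have "\<dots> = measure (restrict_space lborel {0<..<1}) (?Q -` (?Q ` T) \<inter> {0<..<1})"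
  proof -
    have "?Q \<in> borel_measurable (restrict_space lborel {0<..<1})"
      using measurable_CI unfolding Q_eq by (simp add: borel_measurable_restrict_space_iff)
    then show ?thesis
      using Q_T by (subst measure_distr) (simp_all add: space_restrict_space)
  qed
  also have "?Q -` (?Q ` T) \<inter> {0<..<1} = T"
    using T(2) inj by (auto simp: inj_on_def)
  also have "measure (restrict_space lborel {0<..<1}) T = measure lborel T"
    using T(2) by (simp add: measure_restrict_space)
  finally show "measure \<mu> (?Q ` T) = measure lborel T" .
qed

text \<open>For Borel \<open>T\<close> inside the set of differentiability, the integral of
  \<open>\<bar>D u\<bar> * \<rho> (quantile \<mu> u)\<close> over \<open>T\<close> equals that of
  \<open>\<rho>\<close> over the image of \<open>T\<close>, which is the
  \<open>\<mu>\<close>-measure of the image and so the length of \<open>T\<close>. The integrand is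
  therefore 1 almost everywhere.\<close>

lemma AE_quantile_deriv:
  fixes \<mu> :: "real measure" and \<rho> D :: "real \<Rightarrow> real"
  assumes \<mu>: "real_distribution \<mu>"
    and \<rho>: "\<rho> \<in> borel_measurable borel" "\<And>x. \<rho> x \<ge> 0"
    and dens: "\<mu> = density lborel (\<lambda>x. ennreal (\<rho> x))"
    and D: "AE u in lborel. u \<in> {0<..<1} \<longrightarrow> (quantile \<mu> has_real_derivative D u) (at u)"
  shows "AE u in lborel. u \<in> {0<..<1} \<longrightarrow> D u > 0 \<and> D u * \<rho> (quantile \<mu> u) = 1"
proof -
  interpret cdf_distribution \<mu> unfolding cdf_distribution_def by (rule \<mu>)
  let ?Q = "quantile \<mu>"
  have no_atom: "measure \<mu> {x} = 0" for x
    unfolding dens using \<rho>(1) by (intro measure_density_lborel_singleton) simp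
  obtain N where N_null: "N \<in> null_sets lborel"
    and N: "{u \<in> space lborel. \<not> (u \<in> {0<..<1} \<longrightarrow> (?Q has_real_derivative D u) (at u))} \<subseteq> N"
    using D unfolding eventually_ae_filter by blast
  \<comment> \<open>Removing a null set \<open>N\<close> from \<open>sets lborel\<close> that
    contains the exceptional points makes \<open>A\<close> Borel.\<close>
  define A where "A = {0<..<1} - N"
  have A: "A \<in> sets borel" "A \<subseteq> {0<..<1}" using N_null unfolding A_def by auto
  have deriv: "(?Q has_real_derivative D u) (at u)" if "u \<in> A" for u
    using N that by (auto simp: A_def)
  have inj: "inj_on ?Q A"
    using A cdf_quantile[OF \<mu> no_atom] by (intro inj_on_inverseI[where g = "cdf \<mu>"]) auto
  have \<rho>_int: "integrable lborel \<rho>"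
  proof -
    have "(\<integral>\<^sup>+x. ennreal (\<rho> x) \<partial>lborel) = emeasure \<mu> (space \<mu>)"
      using \<rho>(1) by (subst dens, subst emeasure_density) (auto simp: dens)
    also have "\<dots> = 1" by (rule emeasure_space_1)
    finally show ?thesis using \<rho> by (intro integrableI_nonneg) auto
  qed
  define G where "G = (\<lambda>u. \<bar>D u\<bar> * \<rho> (?Q u))"
  have G: "G absolutely_integrable_on T \<and> integral T G = measure lborel T"
    if T: "T \<in> sets borel" "T \<subseteq> A" for T
  proof -
    have T': "T \<subseteq> {0<..<1}" using T A by auto
    note img = measure_quantile_image[OF \<mu> no_atom T(1) T']
    have \<rho>_T: "set_integrable lborel (?Q ` T) \<rho>"
      unfolding set_integrable_def using img(1) by (intro integrable_mult_indicator \<rho>_int) simp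
    then have abs: "\<rho> absolutely_integrable_on (?Q ` T)"
      unfolding set_integrable_def by (subst integrable_completion) (use \<rho> img in auto)
    have "integral (?Q ` T) \<rho> = (LINT x:?Q ` T|lebesgue. \<rho> x)"
      by (rule set_lebesgue_integral_eq_integral(2)[OF abs, symmetric])
    also have "\<dots> = (LINT x:?Q ` T|lborel. \<rho> x)"
      unfolding set_lebesgue_integral_def by (rule integral_completion) (use \<rho> img in auto)
    also have "\<dots> = measure \<mu> (?Q ` T)"
    proof -
      have "emeasure \<mu> (?Q ` T) = (\<integral>\<^sup>+x. ennreal (indicator (?Q ` T) x *\<^sub>R \<rho> x) \<partial>lborel)"
        using \<rho> img by (subst dens, subst emeasure_density) (auto intro!: nn_integral_cong simp: indicator_def)
      also have "\<dots> = ennreal (LINT x:?Q ` T|lborel. \<rho> x)"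
        unfolding set_lebesgue_integral_def using \<rho>_T \<rho>(2)
        by (intro nn_integral_eq_integral) (auto simp: set_integrable_def)
      finally show ?thesis
        using \<rho>(2) by (simp add: measure_def set_lebesgue_integral_def integral_nonneg)
    qed
    also have "\<dots> = measure lborel T" by (rule img(2))
    finally have "\<rho> absolutely_integrable_on (?Q ` T) \<and> integral (?Q ` T) \<rho> = measure lborel T"
      using abs by blast
    then show ?thesis
      unfolding G_def
      by (subst has_absolute_integral_change_of_variables_1')
        (use T deriv inj in \<open>auto intro: DERIV_subset has_field_derivative_at_within inj_on_subset\<close>)
  qed
  have G_A: "integrable lebesgue (\<lambda>u. indicator A u *\<^sub>R G u)"
    using G[OF A(1)] unfolding set_integrable_def by blast
  \<comment> \<open>The change of variables gives integrability of \<open>G\<close> only over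
    \<open>lebesgue\<close>; a Borel representative \<open>G'\<close> is needed to compare densities
    over \<open>lborel\<close>.\<close>
  obtain G' where G': "G' \<in> borel_measurable lborel" and GG': "AE u in lborel. indicator A u *\<^sub>R G u = G' u"
    using completion_ex_borel_measurable_real[OF borel_measurable_integrable[OF G_A]] by blast
  have GG'_leb: "AE u in lebesgue. G' u = indicator A u *\<^sub>R G u"
    using AE_completion[OF GG'] by eventually_elim simp
  have "integrable lebesgue G'"
    using G_A G' by (subst integrable_cong_AE[OF _ _ GG'_leb]) (simp_all add: measurable_completion)
  then have G'_int: "integrable lborel G'" using G' integrable_completion[of G' lborel] by simp
  have "AE u in lborel. G' u = indicator A u"
  proof (rule sigma_finite_measure.density_unique_banach[OF sigma_finite_lborel G'_int])
    show "integrable lborel (indicat_real A)"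
      using A emeasure_mono[of A "{0<..<1}" lborel] by (auto simp: less_top[symmetric] top_unique intro!: integrable_real_indicator)
    fix E :: "real set" assume "E \<in> sets lborel"
    then have E: "E \<in> sets borel" by simp
    have "set_lebesgue_integral lborel E G' = (LINT u|lebesgue. indicator E u *\<^sub>R G' u)"
      unfolding set_lebesgue_integral_def by (rule integral_completion[symmetric]) (use E G' in auto)
    also have "\<dots> = (LINT u|lebesgue. indicator E u *\<^sub>R (indicator A u *\<^sub>R G u))"
    proof (rule integral_cong_AE)
      have E': "E \<in> sets lebesgue" using E by simp
      show "(\<lambda>u. indicator E u *\<^sub>R G' u) \<in> borel_measurable lebesgue"
        using E' G' by (intro borel_measurable_scaleR borel_measurable_indicator measurable_completion)
      show "(\<lambda>u. indicator E u *\<^sub>R (indicator A u *\<^sub>R G u)) \<in> borel_measurable lebesgue"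
        using E' G_A by (intro borel_measurable_scaleR borel_measurable_indicator borel_measurable_integrable)
      show "AE u in lebesgue. indicator E u *\<^sub>R G' u = indicator E u *\<^sub>R (indicator A u *\<^sub>R G u)"
        using GG'_leb by eventually_elim simp
    qed
    also have "\<dots> = (LINT u:E \<inter> A|lebesgue. G u)"
      unfolding set_lebesgue_integral_def by (intro Bochner_Integration.integral_cong) (auto simp: indicator_def)
    also have "\<dots> = measure lborel (E \<inter> A)"
      using G[of "E \<inter> A"] E A set_lebesgue_integral_eq_integral(2)[of "E \<inter> A" G] by auto
    also have "\<dots> = set_lebesgue_integral lborel E (indicat_real A)"
      unfolding set_lebesgue_integral_def using E A by (simp flip: indicator_inter_arith)
    finally show "set_lebesgue_integral lborel E G' = set_lebesgue_integral lborel E (indicat_real A)" .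
  qed
  then have "AE u in lborel. indicator A u *\<^sub>R G u = indicator A u"
    using GG' by eventually_elim simp
  moreover have "AE u in lborel. u \<notin> N" using N_null by (rule AE_not_in)
  ultimately show ?thesis
  proof eventually_elim
    case (elim u)
    show ?case
    proof
      assume u: "u \<in> {0<..<1}"
      then have "u \<in> A" using elim by (simp add: A_def)
      then have G1: "\<bar>D u\<bar> * \<rho> (?Q u) = 1" using elim by (simp add: G_def)
      \<comment> \<open>Monotonicity removes the absolute value, and the product being 1 excludes a
        zero derivative.\<close>
      have "mono_on {0<..<1} ?Q"
        using mono_I by (simp add: quantile_def[abs_def])
      then have "D u \<ge> 0"
        by (rule mono_on_imp_deriv_nonneg[OF _ deriv[OF \<open>u \<in> A\<close>]]) (use u in simp)
      then show "D u > 0 \<and> D u * \<rho> (?Q u) = 1" using G1 by (cases "D u = 0") auto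
    qed
  qed
qed

section \<open>The Skorokhod energy\<close>

text \<open>Composing each map with the inverse of the other gives self-maps \<open>\<phi>\<close>
  and \<open>\<psi>\<close> of the disc that fix 0 and satisfy
  \<open>\<psi> (\<phi> z0) = z0\<close>. The Schwarz lemma for both forces
  \<open>norm (\<phi> z0) = norm z0\<close>, and equality at a nonzero point makes
  \<open>\<phi>\<close> a rotation.\<close>

lemma univalent_onto_rotation:
  assumes f: "univalent_onto f U" and h: "univalent_onto h U"
  shows "\<exists>\<alpha>. norm \<alpha> = 1 \<and> (\<forall>z\<in>ball 0 1. f z = h (\<alpha> * z))"
proof -
  let ?D = "ball 0 1 :: complex set"
  have lift: "\<exists>\<phi>. \<phi> holomorphic_on ?D \<and> \<phi> ` ?D \<subseteq> ?D \<and> \<phi> 0 = 0 \<and> (\<forall>z\<in>?D. h (\<phi> z) = f z)"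
    if f: "univalent_onto f U" and h: "univalent_onto h U" for f h
  proof -
    have hol: "f holomorphic_on ?D" "h holomorphic_on ?D" and inj: "inj_on h ?D"
      and img: "f ` ?D = U" "h ` ?D = U" and zero: "f 0 = 0" "h 0 = 0"
      using f h unfolding univalent_onto_def by auto
    obtain g where g: "g holomorphic_on h ` ?D" "\<And>z. z \<in> ?D \<Longrightarrow> g (h z) = z"
      using holomorphic_has_inverse[OF hol(2) open_ball inj] by metis
    have gU: "g w \<in> ?D" "h (g w) = w" if "w \<in> U" for w
      using that g(2) img(2) by auto
    have "g \<circ> f holomorphic_on ?D"
      using hol(1) g(1) img by (intro holomorphic_on_compose) simp_all
    moreover have "(g \<circ> f) ` ?D \<subseteq> ?D" using gU(1) img(1) by auto
    moreover have "(g \<circ> f) 0 = 0" using g(2)[of 0] zero by simp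
    moreover have "\<forall>z\<in>?D. h ((g \<circ> f) z) = f z" using gU(2) img(1) by auto
    ultimately show ?thesis by blast
  qed
  obtain \<phi> where \<phi>: "\<phi> holomorphic_on ?D" "\<phi> ` ?D \<subseteq> ?D" "\<phi> 0 = 0" "\<And>z. z \<in> ?D \<Longrightarrow> h (\<phi> z) = f z"
    using lift[OF f h] by blast
  obtain \<psi> where \<psi>: "\<psi> holomorphic_on ?D" "\<psi> ` ?D \<subseteq> ?D" "\<psi> 0 = 0" "\<And>z. z \<in> ?D \<Longrightarrow> f (\<psi> z) = h z"
    using lift[OF h f] by blast
  have \<phi>_disc: "norm (\<phi> z) < 1" if "norm z < 1" for z using that \<phi>(2) by (auto simp: image_subset_iff)
  have \<psi>_disc: "norm (\<psi> z) < 1" if "norm z < 1" for z using that \<psi>(2) by (auto simp: image_subset_iff)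
  define z0 :: complex where "z0 = 1 / 2"
  have z0: "norm z0 < 1" "z0 \<noteq> 0" by (auto simp: z0_def norm_divide)
  have "f (\<psi> (\<phi> z0)) = f z0" using \<phi>(4) \<psi>(4) z0 \<phi>_disc by simp
  then have "\<psi> (\<phi> z0) = z0"
    using f z0 \<psi>_disc \<phi>_disc unfolding univalent_onto_def inj_on_def by simp
  moreover have "norm (\<psi> (\<phi> z0)) \<le> norm (\<phi> z0)"
    by (rule Schwarz_Lemma(1)[OF \<psi>(1,3) \<psi>_disc]) (use \<phi>_disc z0 in auto)
  moreover have "norm (\<phi> z0) \<le> norm z0"
    by (rule Schwarz_Lemma(1)[OF \<phi>(1,3) \<phi>_disc z0(1)])
  ultimately have "norm (\<phi> z0) = norm z0" by simp
  then have "\<exists>\<alpha>. (\<forall>z. norm z < 1 \<longrightarrow> \<phi> z = \<alpha> * z) \<and> norm \<alpha> = 1"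
    using z0 by (intro Schwarz_Lemma(3)[OF \<phi>(1,3) \<phi>_disc z0(1)]) auto
  then obtain \<alpha> where \<alpha>: "norm \<alpha> = 1" "\<And>z. norm z < 1 \<Longrightarrow> \<phi> z = \<alpha> * z" by blast
  have "f z = h (\<alpha> * z)" if "z \<in> ball 0 1" for z
    using \<phi>(4)[OF that] \<alpha>(2)[of z] that by simp
  with \<alpha>(1) show ?thesis by blast
qed

text \<open>A rotation by \<open>\<alpha>\<close> multiplies the n-th coefficient by
  \<open>\<alpha> ^ n\<close>, of modulus 1. Hence the map chosen by \<open>SOME\<close> in the
  energy can be replaced by any explicit one.\<close>

lemma norm_fps_expansion_univalent_onto:
  assumes f: "univalent_onto f U" and h: "univalent_onto h U"
  shows "norm (fps_nth (fps_expansion f 0) n) = norm (fps_nth (fps_expansion h 0) n)"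
proof -
  obtain \<alpha> where \<alpha>: "norm \<alpha> = 1" "\<And>z. z \<in> ball 0 1 \<Longrightarrow> f z = h (\<alpha> * z)"
    using univalent_onto_rotation[OF f h] by blast
  have "\<forall>\<^sub>F z in nhds 0. z \<in> ball (0 :: complex) 1"
    by (intro eventually_nhds_in_open) auto
  then have "\<forall>\<^sub>F z in nhds 0. f z = h (\<alpha> * z)"
    by eventually_elim (rule \<alpha>(2))
  then have "(deriv ^^ n) f 0 = (deriv ^^ n) (\<lambda>z. h (\<alpha> * z)) 0"
    by (rule higher_deriv_cong_ev) simp
  also have "\<dots> = \<alpha> ^ n * (deriv ^^ n) h (\<alpha> * 0)"
    using h \<alpha>(1) by (intro higher_deriv_compose_linear[where S = "ball 0 1" and T = "ball 0 1"])
      (auto simp: univalent_onto_def norm_mult)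
  finally show ?thesis
    using \<alpha>(1) by (simp add: fps_expansion_def norm_mult norm_divide norm_power)
qed

lemma skorokhod_energy_univalent_onto:
  assumes h: "univalent_onto h U"
  shows "skorokhod_energy U = (\<Sum>n. ennreal ((real n)\<^sup>2 * (cmod (fps_nth (fps_expansion h 0) n))\<^sup>2)) / 4"
  using norm_fps_expansion_univalent_onto[OF someI[of "\<lambda>f. univalent_onto f U", OF h] h]
  by (simp add: skorokhod_energy_def Let_def)

section \<open>From the sine series to the energy formula\<close>

lemma AE_lborel_mult:
  assumes "c \<noteq> 0" "AE x in lborel. P x"
  shows "AE x in lborel. P (c * x :: real)"
proof -
  have "AE x in density (distr lborel borel (\<lambda>x. 0 + c * x)) (\<lambda>_. ennreal \<bar>c\<bar>). P x"
    using assms(2) by (subst (asm) lborel_real_affine[OF assms(1), of 0])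
  then have "AE x in distr lborel borel (\<lambda>x. 0 + c * x). P x"
    using assms(1) by (subst (asm) AE_density) auto
  then show ?thesis by (subst (asm) add_0) (rule AE_distrD[rotated], auto)
qed

text \<open>\<open>\<Psi>\<close> is minus the series \<open>F\<close> with coefficients b n / n,
  which is univalent. The weight n^2 in the energy cancels the division by \<open>n\<close>, leaving
  a quarter of the sum of (b n)^2, and Parseval's identity supplies the factor 2/pi.\<close>

lemma skorokhod_energy_sine_series:
  assumes \<Psi>: "\<And>z. z \<in> ball 0 1 \<Longrightarrow>
      \<Psi> z = (\<Sum>n. complex_of_real (- (sine_coeff g (Suc n) / real (Suc n))) * z ^ Suc n)"
    and g: "integrable lborel_0_pi g" and g_pos: "AE t in lborel_0_pi. g t > 0"
  shows "skorokhod_energy (\<Psi> ` ball 0 1) =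
    ennreal (1 / (2 * pi)) * (\<integral>\<^sup>+t. ennreal ((g t)\<^sup>2) \<partial>lborel_0_pi)"
proof -
  define F where "F = Abs_fps (\<lambda>n. complex_of_real (sine_coeff g n / real n))"
  have F: "fps_nth F n = complex_of_real (sine_coeff g n / real n)" for n
    by (simp add: F_def)
  have rad: "fps_conv_radius F \<ge> 1" and inj: "inj_on (eval_fps F) (ball 0 1)"
    using inj_on_disc_sine_series[OF g g_pos F] by auto
  have z_rad: "ereal (norm z) < fps_conv_radius F" if "z \<in> ball 0 1" for z :: complex
  proof -
    have "ereal (norm z) < 1" using that by simp
    then show ?thesis using rad by (rule less_le_trans)
  qed
  have \<Psi>_F: "\<Psi> z = - eval_fps F z" if z: "z \<in> ball 0 1" for z
  proof -
    have "(\<lambda>n. fps_nth F n * z ^ n) sums eval_fps F z"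
      unfolding eval_fps_def by (intro summable_sums summable_fps z_rad z)
    then have "(\<lambda>n. fps_nth F (Suc n) * z ^ Suc n) sums eval_fps F z"
      by (subst sums_Suc_iff) (simp add: F)
    from sums_unique[OF sums_minus[OF this]] show ?thesis
      unfolding \<Psi>[OF z] F by simp
  qed
  have univ: "univalent_onto (\<lambda>z. - eval_fps F z) (\<Psi> ` ball 0 1)"
    unfolding univalent_onto_def
  proof (intro conjI)
    show "(\<lambda>z. - eval_fps F z) holomorphic_on ball 0 1"
      using z_rad by (intro holomorphic_intros) auto
    show "inj_on (\<lambda>z. - eval_fps F z) (ball 0 1)"
      using inj by (simp add: inj_on_def)
    show "(\<lambda>z. - eval_fps F z) ` ball 0 1 = \<Psi> ` ball 0 1"
      by (intro image_cong) (simp_all add: \<Psi>_F)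
    show "- eval_fps F 0 = 0" by (simp add: eval_fps_at_0 F)
  qed
  have "fps_conv_radius F > 0" using rad by (rule less_le_trans[rotated]) simp
  then have "(\<lambda>z. - eval_fps F z) has_fps_expansion - F"
    by (intro has_fps_expansion_minus eval_fps_has_fps_expansion)
  from fps_nth_fps_expansion[OF this]
  have coeff: "fps_nth (fps_expansion (\<lambda>z. - eval_fps F z) 0) n = - fps_nth F n" for n
    by (simp add: fps_expansion_def)
  have "(real n)\<^sup>2 * (cmod (- fps_nth F n))\<^sup>2 = (sine_coeff g n)\<^sup>2" for n
    unfolding F norm_minus_cancel norm_of_real power2_abs
    by (cases "n = 0") (simp add: sine_coeff_def, simp add: power_divide)
  then have "skorokhod_energy (\<Psi> ` ball 0 1) = (\<Sum>n. ennreal ((sine_coeff g n)\<^sup>2)) / 4"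
    unfolding skorokhod_energy_univalent_onto[OF univ] coeff by simp
  also have "\<dots> = ennreal (2 / pi) * (\<integral>\<^sup>+t. ennreal ((g t)\<^sup>2) \<partial>lborel_0_pi) * ennreal (1 / 4)"
  proof -
    have "inverse 4 = ennreal (1 / 4)"
      using inverse_ennreal[of 4] by (simp add: inverse_eq_divide)
    then show ?thesis unfolding sine_Parseval[OF g] by (simp only: divide_ennreal_def)
  qed
  also have "\<dots> = ennreal (1 / (2 * pi)) * (\<integral>\<^sup>+t. ennreal ((g t)\<^sup>2) \<partial>lborel_0_pi)"
  proof -
    have "ennreal (2 / pi) * ennreal (1 / 4) = ennreal (1 / (2 * pi))"
      by (subst ennreal_mult'[symmetric]) (simp_all add: field_simps)
    then show ?thesis by (simp only: mult.assoc mult.commute[of _ "ennreal (1 / 4)"] flip: mult.assoc)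
  qed
  finally show ?thesis .
qed

text \<open>An odd function times the sine is even, so the two halves of (-pi, pi) contribute
  equally; this turns the factor 1/pi into 2/pi.\<close>

lemma fourier_sin_odd:
  assumes int: "set_integrable lborel {-pi<..<pi} h"
    and odd: "AE t in lborel. t \<in> {0<..<pi} \<longrightarrow> h (- t) = - h t"
  shows "fourier_sin h n = sine_coeff h n"
proof -
  define k where "k = (\<lambda>t. indicator {0<..<pi} t *\<^sub>R (h t * sin (real n * t)))"
  define l where "l = (\<lambda>t. indicator {-pi<..<0} t *\<^sub>R (h t * sin (real n * t)))"
  have int_sub: "integrable lborel (\<lambda>t. indicator S t *\<^sub>R (h t * sin (real n * t)))"
    if "S \<in> sets borel" "S \<subseteq> {-pi<..<pi}" for S
  proof -
    have "set_integrable lborel S h" using that by (intro set_integrable_subset[OF int]) auto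
    from integrable_mult_bounded[OF this[unfolded set_integrable_def], of "\<lambda>t. sin (real n * t)" 1]
    show ?thesis by (simp add: mult.assoc)
  qed
  have k_int: "integrable lborel k" and l_int: "integrable lborel l"
    unfolding k_def l_def by (intro int_sub; force)+
  have "(LINT t:{-pi<..<pi}|lborel. h t * sin (real n * t)) = (LINT t|lborel. k t + l t)"
    unfolding set_lebesgue_integral_def
  proof (rule integral_cong_AE)
    show "(\<lambda>t. indicator {-pi<..<pi} t *\<^sub>R (h t * sin (real n * t))) \<in> borel_measurable lborel"
      by (intro borel_measurable_integrable int_sub) auto
    show "(\<lambda>t. k t + l t) \<in> borel_measurable lborel"
      using k_int l_int by (intro borel_measurable_add borel_measurable_integrable)
    show "AE t in lborel. indicator {-pi<..<pi} t *\<^sub>R (h t * sin (real n * t)) = k t + l t"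
      using AE_lborel_singleton[of 0] by eventually_elim (auto simp: k_def l_def indicator_def)
  qed
  also have "\<dots> = integral\<^sup>L lborel k + integral\<^sup>L lborel l"
    using k_int l_int by simp
  also have "integral\<^sup>L lborel l = (LINT t|lborel. l (- t))"
    using lborel_integral_real_affine[of "-1" l 0] by simp
  also have "\<dots> = integral\<^sup>L lborel k"
  proof (rule integral_cong_AE)
    show "(\<lambda>t. l (- t)) \<in> borel_measurable lborel"
      using borel_measurable_integrable[OF l_int] by simp
    show "AE t in lborel. l (- t) = k t"
      using odd by eventually_elim (auto simp: k_def l_def indicator_def)
  qed (use k_int in simp)
  also have "integral\<^sup>L lborel k = (LINT t|lborel_0_pi. h t * sin (real n * t))"
    unfolding k_def by (subst integral_restrict_space) simp_all
  finally show ?thesis by (simp add: fourier_sin_def sine_coeff_def)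
qed

theorem theorem6:
  fixes \<mu> :: "real measure" and p :: real and \<rho> q q' :: "real \<Rightarrow> real"
  assumes "real_distribution \<mu>"
    and "p > 1"
    and "integrable \<mu> (\<lambda>x. \<bar>x\<bar> powr p)"
    and "(LINT x|\<mu>. x) = 0"
    and "\<rho> \<in> borel_measurable borel"
    and "\<And>x. \<rho> x \<ge> 0"
    and "\<mu> = density lborel (\<lambda>x. ennreal (\<rho> x))"
    and "\<And>\<theta>. q (\<theta> + 2 * pi) = q \<theta>"
    and "\<And>\<theta>. \<theta> \<in> {-pi<..<pi} \<Longrightarrow> q \<theta> = quantile \<mu> (\<bar>\<theta>\<bar> / pi)"
    and "AE \<theta> in lborel. \<theta> \<in> {-pi<..<pi} \<longrightarrow> (q has_real_derivative q' \<theta>) (at \<theta>)"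
    and "set_integrable lborel {-pi<..<pi} q'"
    and "fourier_series_termwise_deriv q q'"
  shows "skorokhod_energy_distr \<mu> =
           ennreal (1 / (2 * pi\<^sup>2)) *
             (\<integral>\<^sup>+x\<in>{0<..<1}. 1 / (ennreal (\<rho> (quantile \<mu> x)))\<^sup>2 \<partial>lborel)"
proof -
  let ?Q = "quantile \<mu>"
  note q = assms(9) and q_deriv = assms(10) and q'_int = assms(11) and termwise = assms(12)
  \<comment> \<open>Since \<open>?Q u = q (pi * u)\<close> on (0, 1), the chain rule makes
    \<open>D\<close> the derivative of the quantile function almost everywhere.\<close>
  define D where "D = (\<lambda>u. pi * q' (pi * u))"
  have "AE u in lborel. u \<in> {0<..<1} \<longrightarrow> (?Q has_real_derivative D u) (at u)"
    using AE_lborel_mult[OF pi_neq_zero q_deriv]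
  proof eventually_elim
    case (elim u)
    show ?case
    proof
      assume u: "u \<in> {0<..<1}"
      then have "pi * u \<in> {-pi<..<pi}" by (auto simp: less_trans[OF _ mult_pos_pos])
      then have "(q has_real_derivative q' (pi * u)) (at (pi * u))" using elim by blast
      moreover have "((\<lambda>v. pi * v) has_real_derivative pi) (at u)"
        by (auto intro!: derivative_eq_intros)
      ultimately have "((\<lambda>v. q (pi * v)) has_real_derivative q' (pi * u) * pi) (at u)"
        by (rule DERIV_chain2)
      then have "((\<lambda>v. q (pi * v)) has_real_derivative D u) (at u)"
        by (simp only: D_def mult.commute)
      then show "(?Q has_real_derivative D u) (at u)"
      proof (rule has_field_derivative_transform_within_open[where S = "{0<..<1}"])
        fix v :: real assume v: "v \<in> {0<..<1}"
        then have "pi * v \<in> {-pi<..<pi}" by (auto simp: less_trans[OF _ mult_pos_pos])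
        then show "q (pi * v) = ?Q v" using q[of "pi * v"] v by (simp add: abs_mult)
      qed (use u in auto)
    qed
  qed
  then have D: "AE u in lborel. u \<in> {0<..<1} \<longrightarrow> D u > 0 \<and> D u * \<rho> (?Q u) = 1"
    by (rule AE_quantile_deriv[OF assms(1,5,6,7)])
  have q'_0_pi: "integrable lborel_0_pi q'"
  proof -
    have "set_integrable lborel {0<..<pi} q'"
      by (rule set_integrable_subset[OF q'_int]) auto
    then show ?thesis by (simp add: set_integrable_def integrable_restrict_space)
  qed
  \<comment> \<open>The strict positivity required for univalence comes from
    \<open>D u * \<rho> (?Q u) = 1\<close>, transported back by
    \<open>\<theta> = pi * u\<close>.\<close>
  have q'_pos: "AE \<theta> in lborel_0_pi. q' \<theta> > 0"
  proof -
    have "AE \<theta> in lborel. 1 / pi * \<theta> \<in> {0<..<1} \<longrightarrow> D (1 / pi * \<theta>) > 0 \<and> D (1 / pi * \<theta>) * \<rho> (?Q (1 / pi * \<theta>)) = 1"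
      by (rule AE_lborel_mult[OF _ D]) simp
    then have "AE \<theta> in lborel. \<theta> \<in> {0<..<pi} \<longrightarrow> q' \<theta> > 0"
      by eventually_elim (auto simp: D_def zero_less_mult_iff)
    then show ?thesis by (subst AE_restrict_space_iff) simp_all
  qed
  \<comment> \<open>\<open>q'\<close> is tied to \<open>q\<close> only almost everywhere, so oddness
    is obtained where \<open>q\<close> is differentiable at both \<open>\<theta>\<close> and
    \<open>- \<theta>\<close>, from evenness of \<open>q\<close> and uniqueness of the
    derivative.\<close>
  have q'_odd: "AE \<theta> in lborel. \<theta> \<in> {0<..<pi} \<longrightarrow> q' (- \<theta>) = - q' \<theta>"
    using q_deriv AE_lborel_mult[of "-1", OF _ q_deriv, simplified]
  proof eventually_elim
    case (elim \<theta>)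
    show ?case
    proof
      assume \<theta>: "\<theta> \<in> {0<..<pi}"
      then have "(q has_real_derivative q' (- \<theta>)) (at (- \<theta>))" using elim by auto
      moreover have "(uminus has_real_derivative - 1) (at \<theta>)"
        by (auto intro!: derivative_eq_intros)
      ultimately have "((\<lambda>x. q (- x)) has_real_derivative q' (- \<theta>) * - 1) (at \<theta>)"
        by (rule DERIV_chain2)
      then have "((\<lambda>x. q (- x)) has_real_derivative - q' (- \<theta>)) (at \<theta>)"
        by simp
      then have "(q has_real_derivative - q' (- \<theta>)) (at \<theta>)"
        by (rule has_field_derivative_transform_within_open[where S = "{-pi<..<pi}"])
          (use \<theta> q in auto)
      moreover have "(q has_real_derivative q' \<theta>) (at \<theta>)" using elim \<theta> by auto
      ultimately show "q' (- \<theta>) = - q' \<theta>" by (metis DERIV_unique minus_minus)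
    qed
  qed
  \<comment> \<open>Termwise differentiation says that the n-th sine coefficient of
    \<open>q'\<close> is - n times the cosine coefficient of \<open>q\<close>.\<close>
  have coeff: "gross_coeff \<mu> n = - (sine_coeff q' n / real n)" if "n > 0" for n
  proof -
    have "gross_coeff \<mu> n = fourier_cos q n"
      unfolding gross_coeff_def fourier_cos_def set_lebesgue_integral_def
      by (intro arg_cong2[of _ _ _ _ "(*)"] refl Bochner_Integration.integral_cong) (auto simp: q indicator_def)
    then have "sine_coeff q' n = - real n * gross_coeff \<mu> n"
      using termwise fourier_sin_odd[OF q'_int q'_odd, of n]
      by (simp add: fourier_series_termwise_deriv_def)
    then show ?thesis using that by simp
  qed
  \<comment> \<open>This is q'(pi u)^2 on (0, 1), cut off by the indicator so that it is Borel on
    the whole line; both sides of the claim are reduced to its integral.\<close>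
  define L where "L = (\<lambda>u. ennreal ((indicator {0<..<pi} (pi * u) *\<^sub>R q' (pi * u))\<^sup>2))"
  have q'_meas: "(\<lambda>\<theta>. indicator {0<..<pi} \<theta> *\<^sub>R q' \<theta>) \<in> borel_measurable borel"
    using borel_measurable_integrable[OF q'_0_pi] by (simp add: borel_measurable_restrict_space_iff)
  have "skorokhod_energy_distr \<mu> =
      ennreal (1 / (2 * pi)) * (\<integral>\<^sup>+\<theta>. ennreal ((q' \<theta>)\<^sup>2) \<partial>lborel_0_pi)"
    unfolding skorokhod_energy_distr_def gross_domain_def
    by (rule skorokhod_energy_sine_series[OF _ q'_0_pi q'_pos])
      (simp add: gross_map_def coeff del: of_nat_Suc)
  also have "(\<integral>\<^sup>+\<theta>. ennreal ((q' \<theta>)\<^sup>2) \<partial>lborel_0_pi) =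
      (\<integral>\<^sup>+\<theta>. ennreal ((indicator {0<..<pi} \<theta> *\<^sub>R q' \<theta>)\<^sup>2) \<partial>lborel)"
    by (subst nn_integral_restrict_space) (auto intro!: nn_integral_cong simp: indicator_def)
  also have "\<dots> = ennreal pi * (\<integral>\<^sup>+u. L u \<partial>lborel)"
    unfolding L_def using q'_meas by (subst nn_integral_real_affine[of _ pi 0]) simp_all
  finally have energy: "skorokhod_energy_distr \<mu> =
    ennreal (1 / (2 * pi)) * (ennreal pi * (\<integral>\<^sup>+u. L u \<partial>lborel))" .
  have "(\<integral>\<^sup>+u\<in>{0<..<1}. 1 / (ennreal (\<rho> (?Q u)))\<^sup>2 \<partial>lborel) = (\<integral>\<^sup>+u. ennreal (pi\<^sup>2) * L u \<partial>lborel)"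
  proof (rule nn_integral_cong_AE)
    show "AE u in lborel. 1 / (ennreal (\<rho> (?Q u)))\<^sup>2 * indicator {0<..<1} u = ennreal (pi\<^sup>2) * L u"
      using D
    proof eventually_elim
      case (elim u)
      show ?case
      proof (cases "u \<in> {0<..<1}")
        case True
        then have "D u > 0" and eq: "D u * \<rho> (?Q u) = 1" using elim by auto
        \<comment> \<open>Positivity of the density makes the extended quotient an ordinary real
          one, equal to (D u)^2 and so to pi^2 q'(pi u)^2.\<close>
        then have \<rho>: "\<rho> (?Q u) > 0" by (metis zero_less_mult_pos zero_less_one)
        have "1 / (ennreal (\<rho> (?Q u)))\<^sup>2 = ennreal 1 / ennreal ((\<rho> (?Q u))\<^sup>2)"
          using \<rho> by (simp add: ennreal_power)
        also have "\<dots> = ennreal (1 / (\<rho> (?Q u))\<^sup>2)"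
          using \<rho> by (intro divide_ennreal) simp_all
        also have "1 / (\<rho> (?Q u))\<^sup>2 = (D u)\<^sup>2"
          using eq \<rho> by (simp add: field_simps flip: power_mult_distrib)
        also have "ennreal ((D u)\<^sup>2) = ennreal (pi\<^sup>2) * ennreal ((q' (pi * u))\<^sup>2)"
          by (subst ennreal_mult'[symmetric]) (simp_all add: D_def power_mult_distrib)
        finally show ?thesis using True by (simp add: L_def)
      next
        case False
        then have "pi * u \<notin> {0<..<pi}" by (auto simp: zero_less_mult_iff)
        then show ?thesis using False by (simp add: L_def)
      qed
    qed
  qed
  also have "\<dots> = ennreal (pi\<^sup>2) * (\<integral>\<^sup>+u. L u \<partial>lborel)"
    using q'_meas unfolding L_def by (intro nn_integral_cmult) simp
  finally have integral: "(\<integral>\<^sup>+u\<in>{0<..<1}. 1 / (ennreal (\<rho> (?Q u)))\<^sup>2 \<partial>lborel) =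
    ennreal (pi\<^sup>2) * (\<integral>\<^sup>+u. L u \<partial>lborel)" .
  \<comment> \<open>Both products equal 1/2, the common factor of the integral of
    \<open>L\<close>.\<close>
  have "ennreal (1 / (2 * pi)) * ennreal pi = ennreal (1 / (2 * pi\<^sup>2)) * ennreal (pi\<^sup>2)"
    by (simp flip: ennreal_mult')
  then show ?thesis
    unfolding energy integral by (simp only: mult.assoc[symmetric])
qed

end
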